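(* Let $Q$ be a real $n$-dimensional vector space, let $L:TQ\to\mathbb{R}$ be a smooth Lagrangian such that $\partial^2L/\partial v^2$ is invertible, let $\gamma_r:Q\to\mathbb{R}$, $r=1,\dots,m$, be stochastic potentials, and let $g:Q\to\mathbb{R}^d$ ($d<n$) be a smooth holonomic constraint function having $0$ as a regular value, with $S=g^{-1}(0)$. Let an $s$-stage Runge-Kutta method with $b$-vector $(b_i)$, all $b_i\neq0$, and $a$-matrix $(a_{ij})$ be given, together with real coefficients $\nu_i,\kappa_i$ ($i=1,\dots,s$) and random variables $\phi_r,\psi_r:\Omega\to\mathbb{R}$ ($r=1,\dots,m$). Let $h>0$, $N\geq1$. Assume that the system ( * ) below has a well-defined solution defining a discrete flow map $F_h:T^*S\to T^*S$, $(q_k,p_k)\mapsto(q_{k+1},p_{k+1})$. Then a discrete curve $c_d\in\mathcal{C}_d(q_1,q_2)$ satisfies the stochastic VPRK method $$( * )\quad\begin{cases} Q_k^i=q_k+h\sum_{j=1}^sa_{ij}V_k^j,\\ q_{k+1}=q_k+h\sum_{j=1}^sb_jV_k^j,\\ P_k^i=p_k+h\sum_{j=1}^s\big(b_j-\tfrac{b_ja_{ji}}{b_i}\big)\big(\tfrac{\partial L}{\partial q}(Q_k^j,V_k^j)+\tfrac{\partial g}{\partial q}(Q_k^j)^*\cdot\Lambda_k^j\big)\\ \qquad\quad+\sum_{j=1}^s\sum_{r=1}^m\big(1-\tfrac{a_{ji}}{b_i}\big)(\nu_j\phi_r+\kappa_j\psi_r)\tfrac{\partial\gamma_r}{\partial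 q}(Q_k^j),\\ p_{k+1}=p_k+h\sum_{j=1}^sb_j\big(\tfrac{\partial L}{\partial q}(Q_k^j,V_k^j)+\tfrac{\partial g}{\partial q}(Q_k^j)^*\cdot\Lambda_k^j\big)+\sum_{j=1}^s\sum_{r=1}^m(\nu_j\phi_r+\kappa_j\psi_r)\tfrac{\partial\gamma_r}{\partial q}(Q_k^j),\\ P_k^i=\tfrac{\partial L}{\partial v}(Q_k^i,V_k^i),\\ g(Q_k^i)=0, \end{cases}$$ for $i=1,\dots,s$ and $k=0,\dots,N-1$, if and only if it is a critical point of the discrete action sum $\mathfrak{G}_d$, that is, $\mathbf{d}\mathfrak{G}_d(\omega,c_d)=0$ (in the sense made precise in the context). Moreover, there exist $\{\Lambda_k^i\}_{i=1}^s$ such that the discrete flow map $F_h:T^*S\to T^*S$ defined by the scheme ( * ) preserves the canonical symplectic form on $T^*S$.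
   Context: Discrete path space: $\mathcal{C}_d(q_1,q_2)$, for two fixed points $q_1,q_2\in Q$, is the set of discrete curves consisting of $q_k\in Q$, $p_k\in Q^*$ ($k=0,\dots,N$) with $q_0=q_1$ and $q_N=q_2$, together with, for each step $k=0,\dots,N-1$, internal stage data $Q_k^i\in Q$, $V_k^i\in Q$, $p_k^i\in Q^*$ and multipliers $\Lambda_k^i\in\mathbb{R}^d$ ($i=1,\dots,s$). Variations satisfy $\delta q_0=\delta q_N=0$ and are otherwise arbitrary. Discrete constrained, stochastic VPRK action sum $\mathfrak{G}_d:\Omega\times\mathcal{C}_d\to\mathbb{R}$: $$\mathfrak{G}_d=\sum_{k=0}^{N-1}\Big\{\sum_{i=1}^s\Big[hb_iL(Q_k^i,V_k^i)+\sum_{r=1}^m(\nu_i\phi_r+\kappa_i\psi_r)\gamma_r(Q_k^i)+hb_i\langle\Lambda_k^i,g(Q_k^i)\rangle+h\Big\langle p_k^i,\tfrac{Q_k^i-q_k}{h}-\sum_{j=1}^sa_{ij}V_k^j\Big\rangle\Big]+h\Big\langle p_{k+1},\tfrac{q_{k+1}-q_k}{h}-\sum_{j=1}^sb_jV_k^j\Big\rangle\Big\}.$$ Precise meaning of the equivalence (for each $\omega$): the variables $p_k^i$ appear only in $\mathfrak{G}_d$, the variables $P_k^i$ only in ( * ), and $p_0$ does not appear in $\mathfrak{G}_d$. Given $(q_k)_{k=0}^N$ with the fixed endpoints, $(p_k)_{k=1}^N$ and $(Q_k^i,V_k^i,\Lambda_k^i)$, the equivalence says: there exist $p_0$ and $P_k^i$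 such that ( * ) holds for all $i=1,\dots,s$, $k=0,\dots,N-1$ if and only if there exist $p_k^i$ such that the resulting curve is a critical point of $\mathfrak{G}_d$. $T^*S$ is regarded as the set of $(q,p)\in T^*Q$ with $g(q)=0$ and $\frac{\partial g}{\partial q}(q)\cdot v=0$, where $v$ is determined by $p=\frac{\partial L}{\partial v}(q,v)$ (the "hidden" velocity constraint). $\frac{\partial g}{\partial q}(q)^*$ denotes the adjoint of $\frac{\partial g}{\partial q}(q)$. *)

theory Defs
  imports "HOL-Probability.Probability"
begin

section \<open>Smooth maps and differentials\<close>

text \<open>On an open set, and in finite dimension, a map is of class $C^k$ iff all iterated directional
  derivatives of order at most $k$ exist as Frechet-differentiable maps, the last being continuous.
  Directional derivatives keep the type of the map, which allows the recursion on the order.\<close>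

primrec Ck_on :: "nat \<Rightarrow> 'a::real_normed_vector set \<Rightarrow> ('a \<Rightarrow> 'b::real_normed_vector) \<Rightarrow> bool" where
  "Ck_on 0 S f \<longleftrightarrow> continuous_on S f"
| "Ck_on (Suc k) S f \<longleftrightarrow>
     (\<forall>x\<in>S. f differentiable (at x)) \<and> (\<forall>v. Ck_on k S (\<lambda>x. frechet_derivative f (at x) v))"

definition smooth_on :: "'a::real_normed_vector set \<Rightarrow> ('a \<Rightarrow> 'b::real_normed_vector) \<Rightarrow> bool" where
  "smooth_on S f \<longleftrightarrow> (\<forall>k. Ck_on k S f)"

definition differential ::
    "('a::real_normed_vector \<Rightarrow> 'b::real_normed_vector) \<Rightarrow> 'a \<Rightarrow> 'a \<Rightarrow>\<^sub>L 'b" where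
  "differential f x = Blinfun (frechet_derivative f (at x))"

text \<open>The configuration space $Q$ is \<^typ>\<open>'q::euclidean_space\<close>; its inner product plays no role.
  The dual $Q^*$ is \<^typ>\<open>'q::euclidean_space \<Rightarrow>\<^sub>L real\<close>, the pairing is evaluation, and
  $TQ = Q \times Q$, $T^*Q = Q \times Q^*$.\<close>

type_synonym 'q dual = "'q \<Rightarrow>\<^sub>L real"

definition dL_dq :: "('q::euclidean_space \<times> 'q \<Rightarrow> real) \<Rightarrow> 'q \<Rightarrow> 'q \<Rightarrow> 'q dual" where
  "dL_dq L q v = differential (\<lambda>x. L (x, v)) q"

definition dL_dv :: "('q::euclidean_space \<times> 'q \<Rightarrow> real) \<Rightarrow> 'q \<Rightarrow> 'q \<Rightarrow> 'q dual" where
  "dL_dv L q v = differential (\<lambda>w. L (q, w)) v"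

definition d2L_dv2 ::
    "('q::euclidean_space \<times> 'q \<Rightarrow> real) \<Rightarrow> 'q \<Rightarrow> 'q \<Rightarrow> 'q \<Rightarrow>\<^sub>L 'q dual" where
  "d2L_dv2 L q v = differential (dL_dv L q) v"

text \<open>The adjoint $(\partial g/\partial q)^*$ maps the dual of $R^d$ to $Q^*$ by precomposition;
  a multiplier $\Lambda \in R^d$ is the functional $\langle\Lambda,\cdot\rangle$.\<close>

definition constraint_force ::
    "('q::euclidean_space \<Rightarrow> real^'d) \<Rightarrow> 'q \<Rightarrow> real^'d \<Rightarrow> 'q dual" where
  "constraint_force g q \<Lambda> = blinfun_inner_right \<Lambda> o\<^sub>L differential g q"

definition zero_is_regular_value :: "('q::euclidean_space \<Rightarrow> real^'d) \<Rightarrow> bool" where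
  "zero_is_regular_value g \<longleftrightarrow> (\<forall>q. g q = 0 \<longrightarrow> surj (blinfun_apply (differential g q)))"


section \<open>Discrete path space and action sum\<close>

text \<open>Only the entries with \<open>k \<le> N\<close> (\<open>pos\<close>, \<open>mom\<close>), respectively \<open>k < N\<close> and
  \<open>1 \<le> i \<le> s\<close> (stage data), belong to the discrete curve; no definition below looks at others.\<close>

record (overloaded) ('q, 'd) discrete_curve =
  pos :: "nat \<Rightarrow> 'q::euclidean_space"
  mom :: "nat \<Rightarrow> 'q dual"
  stage_pos :: "nat \<Rightarrow> nat \<Rightarrow> 'q"
  stage_vel :: "nat \<Rightarrow> nat \<Rightarrow> 'q"
  stage_mom :: "nat \<Rightarrow> nat \<Rightarrow> 'q dual"
  multiplier :: "nat \<Rightarrow> nat \<Rightarrow> real^'d::finite"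

definition path_space ::
    "nat \<Rightarrow> 'q::euclidean_space \<Rightarrow> 'q \<Rightarrow> ('q, 'd::finite) discrete_curve set" where
  "path_space N q1 q2 = {c. pos c 0 = q1 \<and> pos c N = q2}"

text \<open>\<open>noise_weight \<nu> \<kappa> \<phi> \<psi> \<omega> i r\<close> is the coefficient of the potential $\gamma_r$ at stage $i$.
  The definitions below take, for fixed $\omega$, this array of coefficients as the argument \<open>W\<close>.\<close>

definition noise_weight ::
    "(nat \<Rightarrow> real) \<Rightarrow> (nat \<Rightarrow> real) \<Rightarrow> (nat \<Rightarrow> 'w \<Rightarrow> real) \<Rightarrow> (nat \<Rightarrow> 'w \<Rightarrow> real) \<Rightarrow> 'w \<Rightarrow> nat \<Rightarrow> nat \<Rightarrow> real" where
  "noise_weight \<nu> \<kappa> \<phi> \<psi> \<omega> i r = \<nu> i * \<phi> r \<omega> + \<kappa> i * \<psi> r \<omega>"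

definition action_sum ::
    "('q::euclidean_space \<times> 'q \<Rightarrow> real) \<Rightarrow> ('q \<Rightarrow> real^'d) \<Rightarrow> (nat \<Rightarrow> 'q \<Rightarrow> real) \<Rightarrow>
     (nat \<Rightarrow> nat \<Rightarrow> real) \<Rightarrow> (nat \<Rightarrow> real) \<Rightarrow> (nat \<Rightarrow> nat \<Rightarrow> real) \<Rightarrow> nat \<Rightarrow> nat \<Rightarrow> real \<Rightarrow> nat \<Rightarrow>
     ('q, 'd::finite) discrete_curve \<Rightarrow> real" where
  "action_sum L g \<gamma> a b W s m h N c =
    (\<Sum>k<N.
      (\<Sum>i=1..s.
          h * b i * L (stage_pos c k i, stage_vel c k i)
        + (\<Sum>r=1..m. W i r * \<gamma> r (stage_pos c k i))
        + h * b i * (multiplier c k i \<bullet> g (stage_pos c k i))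
        + h * blinfun_apply (stage_mom c k i)
            ((1 / h) *\<^sub>R (stage_pos c k i - pos c k) - (\<Sum>j=1..s. a i j *\<^sub>R stage_vel c k j)))
      + h * blinfun_apply (mom c (Suc k))
            ((1 / h) *\<^sub>R (pos c (Suc k) - pos c k) - (\<Sum>j=1..s. b j *\<^sub>R stage_vel c k j)))"

definition vary ::
    "('q::euclidean_space, 'd::finite) discrete_curve \<Rightarrow> ('q, 'd) discrete_curve \<Rightarrow> real \<Rightarrow>
     ('q, 'd) discrete_curve" where
  "vary c \<delta> \<epsilon> = \<lparr>
     pos = (\<lambda>k. pos c k + \<epsilon> *\<^sub>R pos \<delta> k),
     mom = (\<lambda>k. mom c k + \<epsilon> *\<^sub>R mom \<delta> k),
     stage_pos = (\<lambda>k i. stage_pos c k i + \<epsilon> *\<^sub>R stage_pos \<delta> k i),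
     stage_vel = (\<lambda>k i. stage_vel c k i + \<epsilon> *\<^sub>R stage_vel \<delta> k i),
     stage_mom = (\<lambda>k i. stage_mom c k i + \<epsilon> *\<^sub>R stage_mom \<delta> k i),
     multiplier = (\<lambda>k i. multiplier c k i + \<epsilon> *\<^sub>R multiplier \<delta> k i)\<rparr>"

text \<open>The differential of \<open>G\<close> on the path space vanishes at \<open>c\<close>: the derivative along every
  variation with fixed endpoints is zero.\<close>

definition critical_point ::
    "nat \<Rightarrow> (('q::euclidean_space, 'd::finite) discrete_curve \<Rightarrow> real) \<Rightarrow>
     ('q, 'd) discrete_curve \<Rightarrow> bool" where
  "critical_point N G c \<longleftrightarrow>
     (\<forall>\<delta>. pos \<delta> 0 = 0 \<and> pos \<delta> N = 0 \<longrightarrow>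
        ((\<lambda>\<epsilon>. G (vary c \<delta> \<epsilon>)) has_real_derivative 0) (at 0))"


section \<open>The stochastic VPRK method\<close>

text \<open>One step from \<open>(q, p)\<close> to \<open>(q', p')\<close> with stage data \<open>Q\<close>, \<open>V\<close>, \<open>P\<close> and multipliers \<open>\<Lambda>\<close>.\<close>

definition vprk_step ::
    "('q::euclidean_space \<times> 'q \<Rightarrow> real) \<Rightarrow> ('q \<Rightarrow> real^'d) \<Rightarrow> (nat \<Rightarrow> 'q \<Rightarrow> real) \<Rightarrow>
     (nat \<Rightarrow> nat \<Rightarrow> real) \<Rightarrow> (nat \<Rightarrow> real) \<Rightarrow> (nat \<Rightarrow> nat \<Rightarrow> real) \<Rightarrow> nat \<Rightarrow> nat \<Rightarrow> real \<Rightarrow>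
     'q \<times> 'q dual \<Rightarrow> 'q \<times> 'q dual \<Rightarrow>
     (nat \<Rightarrow> 'q) \<Rightarrow> (nat \<Rightarrow> 'q) \<Rightarrow> (nat \<Rightarrow> 'q dual) \<Rightarrow> (nat \<Rightarrow> real^'d::finite) \<Rightarrow> bool" where
  "vprk_step L g \<gamma> a b W s m h x x' Q V P \<Lambda> \<longleftrightarrow>
    (case x of (q, p) \<Rightarrow> case x' of (q', p') \<Rightarrow>
      (\<forall>i\<in>{1..s}. Q i = q + h *\<^sub>R (\<Sum>j=1..s. a i j *\<^sub>R V j)) \<and>
      q' = q + h *\<^sub>R (\<Sum>j=1..s. b j *\<^sub>R V j) \<and>
      (\<forall>i\<in>{1..s}. P i = p
         + h *\<^sub>R (\<Sum>j=1..s. (b j - b j * a j i / b i) *\<^sub>R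
                    (dL_dq L (Q j) (V j) + constraint_force g (Q j) (\<Lambda> j)))
         + (\<Sum>j=1..s. \<Sum>r=1..m. ((1 - a j i / b i) * W j r) *\<^sub>R differential (\<gamma> r) (Q j))) \<and>
      p' = p
         + h *\<^sub>R (\<Sum>j=1..s. b j *\<^sub>R
                    (dL_dq L (Q j) (V j) + constraint_force g (Q j) (\<Lambda> j)))
         + (\<Sum>j=1..s. \<Sum>r=1..m. W j r *\<^sub>R differential (\<gamma> r) (Q j)) \<and>
      (\<forall>i\<in>{1..s}. P i = dL_dv L (Q i) (V i)) \<and>
      (\<forall>i\<in>{1..s}. g (Q i) = 0))"

text \<open>$T^*S$ as a subset of $T^*Q$: configuration constraint and hidden velocity constraint.\<close>

definition cotangent_S ::
    "('q::euclidean_space \<times> 'q \<Rightarrow> real) \<Rightarrow> ('q \<Rightarrow> real^'d::finite) \<Rightarrow> ('q \<times> 'q dual) set" where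
  "cotangent_S L g =
     {(q, p). g q = 0 \<and> (\<exists>v. p = dL_dv L q v \<and> blinfun_apply (differential g q) v = 0)}"

text \<open>\<open>F\<close> is a flow map of the method on $T^*S$ with multipliers \<open>\<Lambda> (q, p) i\<close>. The stage
  quantities solving the system are required to depend differentiably on \<open>(q, p) \<in> T^*S\<close>, without
  which the action of \<open>F\<close> on differential forms is not available.\<close>

definition vprk_flow ::
    "('q::euclidean_space \<times> 'q \<Rightarrow> real) \<Rightarrow> ('q \<Rightarrow> real^'d) \<Rightarrow> (nat \<Rightarrow> 'q \<Rightarrow> real) \<Rightarrow>
     (nat \<Rightarrow> nat \<Rightarrow> real) \<Rightarrow> (nat \<Rightarrow> real) \<Rightarrow> (nat \<Rightarrow> nat \<Rightarrow> real) \<Rightarrow> nat \<Rightarrow> nat \<Rightarrow> real \<Rightarrow>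
     ('q \<times> 'q dual \<Rightarrow> 'q \<times> 'q dual) \<Rightarrow> ('q \<times> 'q dual \<Rightarrow> nat \<Rightarrow> real^'d::finite) \<Rightarrow> bool" where
  "vprk_flow L g \<gamma> a b W s m h F \<Lambda> \<longleftrightarrow>
    F ` cotangent_S L g \<subseteq> cotangent_S L g \<and>
    (\<forall>i\<in>{1..s}. (\<lambda>x. \<Lambda> x i) differentiable_on cotangent_S L g) \<and>
    (\<exists>Q V P.
       (\<forall>i\<in>{1..s}. (\<lambda>x. Q x i) differentiable_on cotangent_S L g \<and>
                   (\<lambda>x. V x i) differentiable_on cotangent_S L g \<and>
                   (\<lambda>x. P x i) differentiable_on cotangent_S L g) \<and>
       (\<forall>x\<in>cotangent_S L g. vprk_step L g \<gamma> a b W s m h x (F x) (Q x) (V x) (P x) (\<Lambda> x)))"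


section \<open>Symplecticity on a subset of the cotangent bundle\<close>

definition tangent_vectors :: "'a::real_normed_vector set \<Rightarrow> 'a \<Rightarrow> 'a set" where
  "tangent_vectors M x =
     {w. \<exists>c \<epsilon>. \<epsilon> > 0 \<and> smooth_on {-\<epsilon><..<\<epsilon>} c \<and> c ` {-\<epsilon><..<\<epsilon>} \<subseteq> M \<and>
              c 0 = x \<and> (c has_vector_derivative w) (at (0::real))}"

text \<open>The form $dq \wedge dp$ on $T^*Q = Q \times Q^*$. The canonical one-form $p\,dq$ of $T^*S$
  depends on $p$ only through its restriction to $T_qS$, so for $T^*S$ embedded in $T^*Q$ the
  canonical form of $T^*S$ is the restriction of this form to tangent vectors of $T^*S$.\<close>

definition canonical_form :: "'q::euclidean_space \<times> 'q dual \<Rightarrow> 'q \<times> 'q dual \<Rightarrow> real" where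
  "canonical_form w1 w2 = blinfun_apply (snd w2) (fst w1) - blinfun_apply (snd w1) (fst w2)"

text \<open>A derivative within \<open>M\<close> is in general not unique, but its values on tangent vectors of \<open>M\<close>
  are; there it is the tangent map of \<open>F\<close>.\<close>

definition preserves_canonical_form ::
    "('q::euclidean_space \<times> 'q dual) set \<Rightarrow> ('q \<times> 'q dual \<Rightarrow> 'q \<times> 'q dual) \<Rightarrow> bool" where
  "preserves_canonical_form M F \<longleftrightarrow>
    (\<forall>x\<in>M. \<exists>F'. (F has_derivative F') (at x within M) \<and>
      (\<forall>w1\<in>tangent_vectors M x. \<forall>w2\<in>tangent_vectors M x.
         canonical_form (F' w1) (F' w2) = canonical_form w1 w2))"

end

theory Submission
  imports Defs
begin

text \<open>
  The random variables enter only through the coefficients \<open>W\<close> of the potentials, so for each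
  \<open>\<omega>\<close> both claims are deterministic. In both, the forces at a stage (Lagrangian, constraint
  and noise) act only through their sum, the stage impulse \<open>I\<^sub>j\<close>, in terms of which the momentum
  equations are \<open>p' = p + \<Sum>\<^sub>j I\<^sub>j\<close> and
  \<open>P\<^sub>i = p + \<Sum>\<^sub>j (1 - a\<^sub>j\<^sub>i/b\<^sub>i) I\<^sub>j\<close>.

  The first variation of the action sum is a sum over the varied quantities (\<open>action_sum_first_variation\<close>).
  Varying the two kinds of momenta and the multipliers gives the position equations and the constraint.
  Varying \<open>Q\<^sub>k\<^sup>i\<close> says that the stage momentum \<open>p\<^sub>k\<^sup>i\<close> is the negative
  impulse; varying \<open>q\<^sub>k\<close> for \<open>0 < k < N\<close> gives \<open>p\<^sub>k\<^sub>+\<^sub>1 = p\<^sub>k - \<Sum>\<^sub>i p\<^sub>k\<^sup>i\<close>; and varying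
  \<open>V\<^sub>k\<^sup>i\<close> gives \<open>b\<^sub>i \<partial>L/\<partial>v = b\<^sub>i p\<^sub>k\<^sub>+\<^sub>1 + \<Sum>\<^sub>j a\<^sub>j\<^sub>i p\<^sub>k\<^sup>j\<close>.
  At \<open>k = 0\<close> the endpoint is fixed, and the missing balance is the definition of \<open>p\<^sub>0\<close>.
  Eliminating the stage momenta yields the method (\<open>discrete_euler_lagrange_iff_vprk_step\<close>).

  For symplecticity, linearize the method along a tangent vector \<open>w\<close> of $T^*S$. The linearized equations
  imply the bilinear identity
  \<open>dp'(w1) (dq'(w2)) = dp(w1) (dq(w2)) + \<Sum>\<^sub>i (dI\<^sub>i(w1) (dQ\<^sub>i(w2)) + h b\<^sub>i dP\<^sub>i(w1) (dV\<^sub>i(w2)))\<close>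
  (\<open>vprk_pairing_identity\<close>). Antisymmetrizing in \<open>w1, w2\<close> turns the left-hand side into the canonical form
  after the step and the first term on the right into the one before it, up to a common sign. The stage
  terms are symmetric, because second derivatives of \<open>L\<close>, \<open>g\<close> and \<open>\<gamma>\<^sub>r\<close> are
  symmetric, except for the contribution of \<open>d\<Lambda>\<^sub>i\<close>. That one is paired with
  \<open>(\<partial>g/\<partial>q) dQ\<^sub>i\<close>, which is zero since all stages stay on the constraint
  (\<open>stage_impulse_has_derivative\<close>). In particular the multipliers are those of the given flow, and they
  may depend on the point in any differentiable way.
\<close>

section \<open>Second derivatives of smooth maps\<close>

lemma smooth_on_has_derivative:
  assumes "smooth_on UNIV f"
  shows "(f has_derivative blinfun_apply (differential f x)) (at x)"
proof -
  have "Ck_on (Suc 0) UNIV f"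
    using assms unfolding smooth_on_def by blast
  then have D: "(f has_derivative frechet_derivative f (at x)) (at x)"
    by (simp add: frechet_derivative_works[symmetric])
  then have "bounded_linear (frechet_derivative f (at x))"
    by (rule has_derivative_bounded_linear)
  with D show ?thesis
    unfolding differential_def by (simp add: bounded_linear_Blinfun_apply)
qed

lemma differential_eqI:
  assumes "(f has_derivative f') (at x)"
  shows "blinfun_apply (differential f x) = f'"
  using frechet_derivative_at[OF assms] has_derivative_bounded_linear[OF assms]
  unfolding differential_def by (simp add: bounded_linear_Blinfun_apply)

lemma smooth_on_differential_apply:
  assumes "smooth_on UNIV f"
  shows "smooth_on UNIV (\<lambda>x. differential f x v)"
  unfolding smooth_on_def
proof
  fix k
  have eq: "(\<lambda>x. frechet_derivative f (at x) v) = (\<lambda>x. differential f x v)"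
    using frechet_derivative_at[OF smooth_on_has_derivative[OF assms]] by metis
  have "Ck_on (Suc k) UNIV f"
    using assms unfolding smooth_on_def by blast
  then show "Ck_on k UNIV (\<lambda>x. differential f x v)"
    unfolding eq[symmetric] by simp
qed

lemma smooth_on_continuous:
  assumes "smooth_on UNIV f"
  shows "continuous_on UNIV f"
  using assms Ck_on.simps(1) unfolding smooth_on_def by blast

text \<open>Two applications of the mean value theorem turn the second-order difference quotient over a
  parallelogram into a mixed second derivative at an interior point. Pairing with a fixed \<open>e\<close>
  makes the mean value theorem available for vector-valued maps.\<close>

lemma second_difference_mean_value:
  fixes f :: "'a::real_normed_vector \<Rightarrow> 'b::real_inner"
  assumes f: "smooth_on UNIV f" and t: "t > 0"
  shows "\<exists>\<alpha> \<beta>. 0 < \<alpha> \<and> \<alpha> < t \<and> 0 < \<beta> \<and> \<beta> < t \<and>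
     (f (x + t *\<^sub>R u + t *\<^sub>R v) - f (x + t *\<^sub>R u) - f (x + t *\<^sub>R v) + f x) \<bullet> e
       = t * t * (differential (\<lambda>y. differential f y u) (x + \<alpha> *\<^sub>R u + \<beta> *\<^sub>R v) v \<bullet> e)"
proof -
  have line: "((\<lambda>\<tau>. F (z + \<tau> *\<^sub>R w) \<bullet> e) has_real_derivative differential F (z + \<tau> *\<^sub>R w) w \<bullet> e) (at \<tau>)"
    if F: "smooth_on UNIV F" for F :: "'a \<Rightarrow> 'b" and z w and \<tau> :: real
  proof -
    have "((\<lambda>\<tau>. F (z + \<tau> *\<^sub>R w)) has_derivative (\<lambda>d. differential F (z + \<tau> *\<^sub>R w) (d *\<^sub>R w))) (at \<tau>)"
      by (rule has_derivative_compose[OF _ smooth_on_has_derivative[OF F]])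
        (auto intro!: derivative_eq_intros)
    from has_derivative_inner_left[OF this, of e] show ?thesis
      by (simp add: has_field_derivative_def blinfun.scaleR_right mult.commute[of _ "_ \<bullet> _"])
  qed
  define \<phi> where "\<phi> \<tau> = f ((x + t *\<^sub>R v) + \<tau> *\<^sub>R u) \<bullet> e - f (x + \<tau> *\<^sub>R u) \<bullet> e" for \<tau>
  have "\<exists>\<alpha>>0. \<alpha> < t \<and> \<phi> t - \<phi> 0 = (t - 0) *
     (differential f ((x + t *\<^sub>R v) + \<alpha> *\<^sub>R u) u \<bullet> e - differential f (x + \<alpha> *\<^sub>R u) u \<bullet> e)"
    unfolding \<phi>_def by (rule MVT2[OF t]) (intro DERIV_diff line[OF f])
  then obtain \<alpha> where \<alpha>: "0 < \<alpha>" "\<alpha> < t" and \<phi>: "\<phi> t - \<phi> 0 = t *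
     (differential f ((x + t *\<^sub>R v) + \<alpha> *\<^sub>R u) u \<bullet> e - differential f (x + \<alpha> *\<^sub>R u) u \<bullet> e)"
    by auto
  have "\<exists>\<beta>>0. \<beta> < t \<and>
      differential f ((x + \<alpha> *\<^sub>R u) + t *\<^sub>R v) u \<bullet> e - differential f ((x + \<alpha> *\<^sub>R u) + 0 *\<^sub>R v) u \<bullet> e
      = (t - 0) * (differential (\<lambda>y. differential f y u) ((x + \<alpha> *\<^sub>R u) + \<beta> *\<^sub>R v) v \<bullet> e)"
    by (rule MVT2[OF t]) (rule line[OF smooth_on_differential_apply[OF f]])
  then obtain \<beta> where \<beta>: "0 < \<beta>" "\<beta> < t" and \<psi>:
      "differential f ((x + \<alpha> *\<^sub>R u) + t *\<^sub>R v) u \<bullet> e - differential f ((x + \<alpha> *\<^sub>R u) + 0 *\<^sub>R v) u \<bullet> e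
      = t * (differential (\<lambda>y. differential f y u) ((x + \<alpha> *\<^sub>R u) + \<beta> *\<^sub>R v) v \<bullet> e)"
    by auto
  have "(f (x + t *\<^sub>R u + t *\<^sub>R v) - f (x + t *\<^sub>R u) - f (x + t *\<^sub>R v) + f x) \<bullet> e = \<phi> t - \<phi> 0"
    by (simp add: \<phi>_def algebra_simps)
  also have "\<dots> = t * t * (differential (\<lambda>y. differential f y u) (x + \<alpha> *\<^sub>R u + \<beta> *\<^sub>R v) v \<bullet> e)"
    using \<phi> \<psi> by (simp add: algebra_simps)
  finally show ?thesis
    using \<alpha> \<beta> by blast
qed

text \<open>The second-order difference is symmetric in the two directions, so both mixed derivatives are
  its limit after division by \<open>t\<^sup>2\<close>.\<close>

lemma mixed_derivatives_commute:
  fixes f :: "'a::real_normed_vector \<Rightarrow> 'b::real_inner"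
  assumes f: "smooth_on UNIV f"
  shows "differential (\<lambda>y. differential f y u) x v = differential (\<lambda>y. differential f y v) x u"
proof -
  define D where "D u v y = differential (\<lambda>y. differential f y u) y v" for u v y
  have cont: "isCont (D u v) y" for u v y
    unfolding D_def
    using smooth_on_continuous[OF smooth_on_differential_apply[OF smooth_on_differential_apply[OF f]]]
    by (simp add: continuous_on_eq_continuous_at)
  have *: "D u v x \<bullet> e = D v u x \<bullet> e" for e
  proof -
    define \<Delta> where "\<Delta> t = (f (x + t *\<^sub>R u + t *\<^sub>R v) - f (x + t *\<^sub>R u) - f (x + t *\<^sub>R v) + f x) \<bullet> e" for t
    define t where "t n = inverse (real (Suc n))" for n
    have t: "t n > 0" for n by (simp add: t_def)
    have t0: "t \<longlonglongrightarrow> 0" unfolding t_def by (rule LIMSEQ_inverse_real_of_nat)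
    have sq: "\<Delta> (t n) = t n * t n * (a \<bullet> e) \<Longrightarrow> \<Delta> (t n) = t n * t n * (b \<bullet> e) \<Longrightarrow> a \<bullet> e = b \<bullet> e"
      for a b n using t[of n] by simp
    have "\<exists>\<alpha> \<beta>. 0 < \<alpha> \<and> \<alpha> < t n \<and> 0 < \<beta> \<and> \<beta> < t n \<and>
      \<Delta> (t n) = t n * t n * (D u v (x + \<alpha> *\<^sub>R u + \<beta> *\<^sub>R v) \<bullet> e)" for n
      unfolding \<Delta>_def D_def by (rule second_difference_mean_value[OF f t])
    then obtain \<alpha> \<beta> where ab: "\<And>n. 0 < \<alpha> n \<and> \<alpha> n < t n \<and> 0 < \<beta> n \<and> \<beta> n < t n \<and>
      \<Delta> (t n) = t n * t n * (D u v (x + \<alpha> n *\<^sub>R u + \<beta> n *\<^sub>R v) \<bullet> e)"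
      by metis
    have sym: "\<Delta> t = (f (x + t *\<^sub>R v + t *\<^sub>R u) - f (x + t *\<^sub>R v) - f (x + t *\<^sub>R u) + f x) \<bullet> e" for t
      unfolding \<Delta>_def by (simp add: algebra_simps)
    have "\<exists>\<alpha> \<beta>. 0 < \<alpha> \<and> \<alpha> < t n \<and> 0 < \<beta> \<and> \<beta> < t n \<and>
      \<Delta> (t n) = t n * t n * (D v u (x + \<alpha> *\<^sub>R v + \<beta> *\<^sub>R u) \<bullet> e)" for n
      unfolding sym D_def by (rule second_difference_mean_value[OF f t])
    then obtain \<alpha>' \<beta>' where ab': "\<And>n. 0 < \<alpha>' n \<and> \<alpha>' n < t n \<and> 0 < \<beta>' n \<and> \<beta>' n < t n \<and>
      \<Delta> (t n) = t n * t n * (D v u (x + \<alpha>' n *\<^sub>R v + \<beta>' n *\<^sub>R u) \<bullet> e)"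
      by metis
    have null: "c \<longlonglongrightarrow> 0" if "\<And>n. 0 < c n \<and> c n < t n" for c
      by (rule tendsto_sandwich[OF _ _ tendsto_const t0])
        (use that in \<open>auto intro!: always_eventually less_imp_le\<close>)
    have lim: "(\<lambda>n. D u v (x + c n *\<^sub>R u' + d n *\<^sub>R v') \<bullet> e) \<longlonglongrightarrow> D u v x \<bullet> e"
      if "c \<longlonglongrightarrow> 0" "d \<longlonglongrightarrow> 0" for c d u v u' v'
    proof -
      have "(\<lambda>n. x + c n *\<^sub>R u' + d n *\<^sub>R v') \<longlonglongrightarrow> x + 0 *\<^sub>R u' + 0 *\<^sub>R v'"
        by (intro tendsto_intros that)
      then have "(\<lambda>n. D u v (x + c n *\<^sub>R u' + d n *\<^sub>R v')) \<longlonglongrightarrow> D u v x"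
        using isCont_tendsto_compose[OF cont[where u = u and v = v and y = x]] by simp
      then show ?thesis by (intro tendsto_intros)
    qed
    have eq: "D u v (x + \<alpha> n *\<^sub>R u + \<beta> n *\<^sub>R v) \<bullet> e = D v u (x + \<alpha>' n *\<^sub>R v + \<beta>' n *\<^sub>R u) \<bullet> e" for n
      using sq ab ab' by blast
    show ?thesis
      using LIMSEQ_unique[OF lim[of \<alpha> \<beta> u v u v] lim[of \<alpha>' \<beta>' v u v u, folded eq]]
        null[of \<alpha>] null[of \<beta>] null[of \<alpha>'] null[of \<beta>'] ab ab' by blast
  qed
  then have "D u v x = D v u x"
    by (metis inner_commute vector_eq_ldot)
  then show ?thesis unfolding D_def .
qed

text \<open>In finite dimension the directional second derivatives assemble into the derivative of
  \<^term>\<open>differential f\<close> as an operator-valued map.\<close>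

lemma differential_has_symmetric_derivative:
  fixes f :: "'a::euclidean_space \<Rightarrow> 'b::real_inner"
  assumes f: "smooth_on UNIV f"
  shows "\<exists>H. (differential f has_derivative H) (at x) \<and>
    (\<forall>u v. blinfun_apply (H u) v = blinfun_apply (H v) u)"
proof -
  define E :: "'b \<Rightarrow> 'a \<Rightarrow> 'a \<Rightarrow>\<^sub>L 'b" where
    "E y b = blinfun_scaleR_left y o\<^sub>L blinfun_inner_left b" for y b
  have E_apply: "blinfun_apply (E y b) u = (u \<bullet> b) *\<^sub>R y" for y b u
    by (simp add: E_def inner_commute)
  have bl: "bounded_linear (\<lambda>y. E y b)" for b
    unfolding E_def by (intro bounded_linear_intros)
  have expand: "(\<Sum>b\<in>Basis. E (A b) b) = A" for A :: "'a \<Rightarrow>\<^sub>L 'b"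
  proof (rule blinfun_eqI)
    fix u
    have "blinfun_apply (\<Sum>b\<in>Basis. E (A b) b) u = A (\<Sum>b\<in>Basis. (u \<bullet> b) *\<^sub>R b)"
      by (simp add: E_apply blinfun.sum_left blinfun.sum_right blinfun.scaleR_right)
    then show "blinfun_apply (\<Sum>b\<in>Basis. E (A b) b) u = A u"
      by (simp add: euclidean_representation)
  qed
  define H where "H w = (\<Sum>b\<in>Basis. E (differential (\<lambda>y. differential f y b) x w) b)" for w
  have "((\<lambda>y. \<Sum>b\<in>Basis. E (differential f y b) b) has_derivative H) (at x)"
    unfolding H_def
    by (intro has_derivative_sum bounded_linear.has_derivative[OF bl]
        smooth_on_has_derivative smooth_on_differential_apply f)
  then have 1: "(differential f has_derivative H) (at x)"
    unfolding expand by simp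
  have H_apply: "blinfun_apply (H w) u = differential (\<lambda>y. differential f y u) x w" for u w
  proof -
    have "differential (\<lambda>y. differential f y u) x w = differential (\<lambda>y. differential f y w) x u"
      by (rule mixed_derivatives_commute[OF f])
    also have "\<dots> = differential (\<lambda>y. differential f y w) x (\<Sum>b\<in>Basis. (u \<bullet> b) *\<^sub>R b)"
      by (simp add: euclidean_representation)
    also have "\<dots> = (\<Sum>b\<in>Basis. (u \<bullet> b) *\<^sub>R differential (\<lambda>y. differential f y w) x b)"
      by (simp add: blinfun.sum_right blinfun.scaleR_right)
    also have "\<dots> = (\<Sum>b\<in>Basis. (u \<bullet> b) *\<^sub>R differential (\<lambda>y. differential f y b) x w)"
      by (simp add: mixed_derivatives_commute[OF f, of w])
    also have "\<dots> = blinfun_apply (H w) u"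
      unfolding H_def by (simp add: E_apply blinfun.sum_left)
    finally show ?thesis ..
  qed
  show ?thesis
    using 1 by (intro exI[of _ H]) (simp add: H_apply mixed_derivatives_commute[OF f])
qed

text \<open>The partial differentials of \<open>L\<close> are the restrictions of its total differential to the two
  factors of $TQ = Q \times Q$.\<close>

definition in_position :: "'q::euclidean_space \<Rightarrow>\<^sub>L ('q \<times> 'q)" where
  "in_position = Blinfun (\<lambda>u. (u, 0))"

definition in_velocity :: "'q::euclidean_space \<Rightarrow>\<^sub>L ('q \<times> 'q)" where
  "in_velocity = Blinfun (\<lambda>u. (0, u))"

lemma in_position_apply [simp]: "blinfun_apply in_position u = (u, 0)"
  unfolding in_position_def
  by (subst bounded_linear_Blinfun_apply) (auto intro!: bounded_linear_Pair bounded_linear_ident bounded_linear_zero)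

lemma in_velocity_apply [simp]: "blinfun_apply in_velocity u = (0, u)"
  unfolding in_velocity_def
  by (subst bounded_linear_Blinfun_apply) (auto intro!: bounded_linear_Pair bounded_linear_ident bounded_linear_zero)

lemma dL_dq_eq:
  assumes "smooth_on UNIV L"
  shows "dL_dq L q v = differential L (q, v) o\<^sub>L in_position"
proof (rule blinfun_eqI)
  fix u
  have "((\<lambda>x. L (x, v)) has_derivative (\<lambda>u. differential L (q, v) (u, 0))) (at q)"
    by (rule has_derivative_compose[OF _ smooth_on_has_derivative[OF assms]])
      (auto intro!: derivative_eq_intros)
  from differential_eqI[OF this] show "dL_dq L q v u = (differential L (q, v) o\<^sub>L in_position) u"
    unfolding dL_dq_def by simp
qed

lemma dL_dv_eq:
  assumes "smooth_on UNIV L"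
  shows "dL_dv L q v = differential L (q, v) o\<^sub>L in_velocity"
proof (rule blinfun_eqI)
  fix u
  have "((\<lambda>x. L (q, x)) has_derivative (\<lambda>u. differential L (q, v) (0, u))) (at v)"
    by (rule has_derivative_compose[OF _ smooth_on_has_derivative[OF assms]])
      (auto intro!: derivative_eq_intros)
  from differential_eqI[OF this] show "dL_dv L q v u = (differential L (q, v) o\<^sub>L in_velocity) u"
    unfolding dL_dv_def by simp
qed

lemma differential_Pair_split:
  assumes "smooth_on UNIV L"
  shows "differential L (q, v) (u, w) = dL_dq L q v u + dL_dv L q v w"
proof -
  have "differential L (q, v) (u, w) = differential L (q, v) ((u, 0) + (0, w))" by simp
  also have "\<dots> = dL_dq L q v u + dL_dv L q v w"
    unfolding dL_dq_eq[OF assms] dL_dv_eq[OF assms] blinfun.add_right by simp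
  finally show ?thesis .
qed

section \<open>The method in terms of stage impulses\<close>

text \<open>The total impulse of stage \<open>j\<close>: Lagrangian force, constraint force and noise. The
  momentum equations of the method and the variation of the stage positions depend on the three
  forces only through this sum.\<close>

definition stage_impulse ::
    "('q::euclidean_space \<times> 'q \<Rightarrow> real) \<Rightarrow> ('q \<Rightarrow> real^'d) \<Rightarrow> (nat \<Rightarrow> 'q \<Rightarrow> real) \<Rightarrow>
     (nat \<Rightarrow> real) \<Rightarrow> (nat \<Rightarrow> nat \<Rightarrow> real) \<Rightarrow> nat \<Rightarrow> real \<Rightarrow>
     nat \<Rightarrow> 'q \<Rightarrow> 'q \<Rightarrow> real^'d::finite \<Rightarrow> 'q dual" where
  "stage_impulse L g \<gamma> b W m h j Q V \<Lambda> =
     (h * b j) *\<^sub>R (dL_dq L Q V + constraint_force g Q \<Lambda>)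
     + (\<Sum>r=1..m. W j r *\<^sub>R differential (\<gamma> r) Q)"

lemma constraint_force_apply:
  "constraint_force g q \<Lambda> u = \<Lambda> \<bullet> differential g q u"
  unfolding constraint_force_def by simp

lemma vprk_step_iff_impulse:
  "vprk_step L g \<gamma> a b W s m h (q, p) (q', p') Q V P \<Lambda> \<longleftrightarrow>
     (let I = (\<lambda>j. stage_impulse L g \<gamma> b W m h j (Q j) (V j) (\<Lambda> j)) in
      (\<forall>i\<in>{1..s}. Q i = q + h *\<^sub>R (\<Sum>j=1..s. a i j *\<^sub>R V j)) \<and>
      q' = q + h *\<^sub>R (\<Sum>j=1..s. b j *\<^sub>R V j) \<and>
      (\<forall>i\<in>{1..s}. P i = p + (\<Sum>j=1..s. (1 - a j i / b i) *\<^sub>R I j)) \<and>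
      p' = p + (\<Sum>j=1..s. I j) \<and>
      (\<forall>i\<in>{1..s}. P i = dL_dv L (Q i) (V i)) \<and>
      (\<forall>i\<in>{1..s}. g (Q i) = 0))"
proof -
  have split: "h *\<^sub>R (\<Sum>j=1..s. (c j * b j) *\<^sub>R (dL_dq L (Q j) (V j) + constraint_force g (Q j) (\<Lambda> j)))
      + (\<Sum>j=1..s. \<Sum>r=1..m. (c j * W j r) *\<^sub>R differential (\<gamma> r) (Q j))
    = (\<Sum>j=1..s. c j *\<^sub>R stage_impulse L g \<gamma> b W m h j (Q j) (V j) (\<Lambda> j))" for c
    unfolding stage_impulse_def
    by (simp only: scaleR_add_right sum.distrib scaleR_sum_right scaleR_scaleR mult_ac)
  have "(b j - b j * a j i / b i) = (1 - a j i / b i) * b j" for i j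
    by (simp add: algebra_simps)
  then show ?thesis
    unfolding vprk_step_def Let_def
    using split[of "\<lambda>j. 1 - a j _ / b _"] split[of "\<lambda>j. 1"]
    by (simp add: add.assoc)
qed

section \<open>Symplecticity\<close>

text \<open>Momentum is paired with position by a discrete Leibniz rule: the coefficients of the momentum
  update are chosen such that the cross terms \<open>I i (V j)\<close> cancel. It is to be
  applied to the linearized method, with the position data \<open>q, Q, V\<close> of one tangent vector and the
  momentum data \<open>p, P, I\<close> of another.\<close>

lemma vprk_pairing_identity:
  fixes q :: "'q::euclidean_space" and p :: "'q dual"
  assumes b: "\<And>i. i \<in> {1..s} \<Longrightarrow> b i \<noteq> (0::real)"
    and Q: "\<And>i. i \<in> {1..s} \<Longrightarrow> Q i = q + h *\<^sub>R (\<Sum>j=1..s. a i j *\<^sub>R V j)"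
    and P: "\<And>i. i \<in> {1..s} \<Longrightarrow> P i = p + (\<Sum>j=1..s. (1 - a j i / b i) *\<^sub>R I j)"
  shows "blinfun_apply (p + (\<Sum>j=1..s. I j)) (q + h *\<^sub>R (\<Sum>j=1..s. b j *\<^sub>R V j))
    = blinfun_apply p q + (\<Sum>i=1..s. I i (Q i) + h * b i * P i (V i))"
proof -
  have "(\<Sum>i=1..s. h * b i * P i (V i)) = (\<Sum>i=1..s. h * b i * p (V i))
      + (\<Sum>i=1..s. \<Sum>j=1..s. h * (b i - a j i) * I j (V i))"
  proof (unfold sum.distrib[symmetric], rule sum.cong[OF refl])
    fix i assume i: "i \<in> {1..s}"
    have "h * b i * P i (V i) = h * b i * p (V i) + (\<Sum>j=1..s. h * b i * ((1 - a j i / b i) * I j (V i)))"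
      by (simp add: P[OF i] blinfun.add_left blinfun.sum_left blinfun.scaleR_left
          distrib_left sum_distrib_left)
    also have "(\<Sum>j=1..s. h * b i * ((1 - a j i / b i) * I j (V i))) = (\<Sum>j=1..s. h * (b i - a j i) * I j (V i))"
      using b[OF i] by (intro sum.cong refl) (simp add: field_simps)
    finally show "h * b i * P i (V i) = h * b i * p (V i) + (\<Sum>j=1..s. h * (b i - a j i) * I j (V i))" .
  qed
  moreover have "(\<Sum>i=1..s. I i (Q i)) = (\<Sum>i=1..s. I i q) + (\<Sum>j=1..s. \<Sum>i=1..s. h * a j i * I j (V i))"
    unfolding sum.distrib[symmetric]
    by (intro sum.cong refl) (simp add: Q blinfun.add_right blinfun.sum_right blinfun.scaleR_right
        sum_distrib_left mult.assoc)
  moreover have "(\<Sum>j=1..s. \<Sum>i=1..s. h * a j i * I j (V i)) = (\<Sum>i=1..s. \<Sum>j=1..s. h * a j i * I j (V i))"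
    by (rule sum.swap)
  moreover have "blinfun_apply (p + (\<Sum>j=1..s. I j)) (q + h *\<^sub>R (\<Sum>j=1..s. b j *\<^sub>R V j))
      = p q + (\<Sum>i=1..s. h * b i * p (V i)) + (\<Sum>i=1..s. I i q) + (\<Sum>i=1..s. \<Sum>j=1..s. h * b i * I j (V i))"
    by (simp add: blinfun.add_left blinfun.sum_left blinfun.add_right blinfun.sum_right
        blinfun.scaleR_right sum_distrib_left distrib_left sum.distrib mult.assoc)
  moreover have "(\<Sum>i=1..s. \<Sum>j=1..s. h * (b i - a j i) * I j (V i))
      = (\<Sum>i=1..s. \<Sum>j=1..s. h * b i * I j (V i)) - (\<Sum>i=1..s. \<Sum>j=1..s. h * a j i * I j (V i))"
    by (simp add: algebra_simps sum_subtractf)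
  ultimately show ?thesis
    by (simp add: sum.distrib)
qed

text \<open>For a step with the linearized equations of the method, the canonical form is therefore
  preserved as soon as each stage separately contributes a symmetric form.\<close>

lemma canonical_form_vprk_step:
  fixes w1 w2 :: "'q::euclidean_space \<times> 'q dual"
  assumes b: "\<And>i. i \<in> {1..s} \<Longrightarrow> b i \<noteq> (0::real)"
    and Q: "\<And>i w. i \<in> {1..s} \<Longrightarrow> w \<in> {w1, w2} \<Longrightarrow> Q i w = fst w + h *\<^sub>R (\<Sum>j=1..s. a i j *\<^sub>R V j w)"
    and P: "\<And>i w. i \<in> {1..s} \<Longrightarrow> w \<in> {w1, w2} \<Longrightarrow> P i w = snd w + (\<Sum>j=1..s. (1 - a j i / b i) *\<^sub>R I j w)"
    and sym: "\<And>i. i \<in> {1..s} \<Longrightarrow>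
      blinfun_apply (I i w1) (Q i w2) + h * b i * blinfun_apply (P i w1) (V i w2)
      = I i w2 (Q i w1) + h * b i * P i w2 (V i w1)"
    and F: "\<And>w. F w = (fst w + h *\<^sub>R (\<Sum>j=1..s. b j *\<^sub>R V j w), snd w + (\<Sum>j=1..s. I j w))"
  shows "canonical_form (F w1) (F w2) = canonical_form w1 w2"
proof -
  have pair: "snd (F w) (fst (F w')) = snd w (fst w') + (\<Sum>i=1..s. I i w (Q i w') + h * b i * P i w (V i w'))"
    if "w \<in> {w1, w2}" "w' \<in> {w1, w2}" for w w'
    unfolding F fst_conv snd_conv
    by (rule vprk_pairing_identity) (use that b Q P in auto)
  have "(\<Sum>i=1..s. I i w1 (Q i w2) + h * b i * P i w1 (V i w2))
      = (\<Sum>i=1..s. I i w2 (Q i w1) + h * b i * P i w2 (V i w1))"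
    by (intro sum.cong refl sym) auto
  then show ?thesis
    unfolding canonical_form_def by (simp add: pair)
qed

text \<open>Although a derivative within \<open>M\<close> is in general not unique, an identity that holds on \<open>M\<close> can
  be differentiated along vectors tangent to \<open>M\<close>.\<close>

lemma derivative_eq_on_tangent_vectors:
  assumes f: "(f has_derivative f') (at x within M)"
    and f2: "(f2 has_derivative f2') (at x within M)"
    and eq: "\<And>y. y \<in> M \<Longrightarrow> f y = f2 y"
    and w: "w \<in> tangent_vectors M x"
  shows "f' w = f2' w"
proof -
  obtain c \<epsilon> where \<epsilon>: "\<epsilon> > 0" and cM: "c ` {-\<epsilon><..<\<epsilon>} \<subseteq> M" and c0: "c 0 = x"
    and c: "(c has_vector_derivative w) (at (0::real))"
    using w unfolding tangent_vectors_def by blast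
  have along: "((\<lambda>t. \<phi> (c t)) has_derivative (\<lambda>t. \<phi>' (t *\<^sub>R w))) (at 0)"
    if \<phi>: "(\<phi> has_derivative \<phi>') (at x within M)" for \<phi> \<phi>'
  proof -
    have "(c has_derivative (\<lambda>t. t *\<^sub>R w)) (at 0 within {-\<epsilon><..<\<epsilon>})"
      using c unfolding has_vector_derivative_def by (rule has_derivative_at_withinI)
    moreover have "(\<phi> has_derivative \<phi>') (at (c 0) within c ` {-\<epsilon><..<\<epsilon>})"
      unfolding c0 by (rule has_derivative_subset[OF \<phi> cM])
    ultimately have "((\<lambda>t. \<phi> (c t)) has_derivative (\<lambda>t. \<phi>' (t *\<^sub>R w))) (at 0 within {-\<epsilon><..<\<epsilon>})"
      by (rule has_derivative_in_compose)
    then show ?thesis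
      using \<epsilon> by (simp add: at_within_open[of 0 "{-\<epsilon><..<\<epsilon>}"])
  qed
  have "((\<lambda>t. f (c t)) has_derivative (\<lambda>t. f2' (t *\<^sub>R w))) (at 0)"
    using along[OF f2]
    by (rule has_derivative_transform_within_open[where s = "{-\<epsilon><..<\<epsilon>}"])
      (use \<epsilon> cM eq in \<open>auto simp: image_subset_iff\<close>)
  from has_derivative_unique[OF along[OF f] this] show ?thesis
    by (metis scaleR_one)
qed

text \<open>For fixed multiplier, the impulse of stage \<open>j\<close> and \<open>h b\<^sub>j\<close> times the stage momentum are the two
  components of the differential of \<open>h b\<^sub>j (L(Q, V) + \<langle>\<Lambda>, g(Q)\<rangle>) + \<Sum>\<^sub>r W\<^sub>j\<^sub>r \<gamma>\<^sub>r(Q)\<close>, so the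
  asserted symmetry is that of the second derivative of this function. The variation of the
  multiplier contributes in addition \<open>\<langle>\<Lambda>' w1, (\<partial>g/\<partial>q) (Q' w2)\<rangle>\<close>, which is zero in
  directions along which \<open>g(Q)\<close> stays zero.\<close>

lemma stage_impulse_has_derivative:
  fixes L :: "'q::euclidean_space \<times> 'q \<Rightarrow> real" and g :: "'q \<Rightarrow> real^'d::finite"
  assumes L: "smooth_on UNIV L" and \<gamma>: "\<And>r. r \<in> {1..m} \<Longrightarrow> smooth_on UNIV (\<gamma> r)"
    and g: "smooth_on UNIV g"
    and Q: "(Q has_derivative Q') (at x within M)" and V: "(V has_derivative V') (at x within M)"
    and \<Lambda>: "(\<Lambda> has_derivative \<Lambda>') (at x within M)"
  obtains I' P' where
    "((\<lambda>y. stage_impulse L g \<gamma> b W m h j (Q y) (V y) (\<Lambda> y)) has_derivative I') (at x within M)"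
    and "((\<lambda>y. dL_dv L (Q y) (V y)) has_derivative P') (at x within M)"
    and "\<And>w1 w2. differential g (Q x) (Q' w1) = 0 \<Longrightarrow> differential g (Q x) (Q' w2) = 0 \<Longrightarrow>
      blinfun_apply (I' w1) (Q' w2) + h * b j * blinfun_apply (P' w1) (V' w2)
      = I' w2 (Q' w1) + h * b j * P' w2 (V' w1)"
proof -
  obtain HL where HL: "(differential L has_derivative HL) (at (Q x, V x))"
    and HL_sym: "\<And>u v. blinfun_apply (HL u) v = blinfun_apply (HL v) u"
    using differential_has_symmetric_derivative[OF L, of "(Q x, V x)"] by blast
  obtain Hg where Hg: "(differential g has_derivative Hg) (at (Q x))"
    and Hg_sym: "\<And>u v. blinfun_apply (Hg u) v = blinfun_apply (Hg v) u"
    using differential_has_symmetric_derivative[OF g, of "Q x"] by blast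
  have "\<exists>H. (differential (\<gamma> r) has_derivative H) (at (Q x)) \<and>
      (\<forall>u v. blinfun_apply (H u) v = blinfun_apply (H v) u)" if "r \<in> {1..m}" for r
    by (rule differential_has_symmetric_derivative[OF \<gamma>[OF that]])
  then obtain H\<gamma> where H\<gamma>: "\<And>r. r \<in> {1..m} \<Longrightarrow> (differential (\<gamma> r) has_derivative H\<gamma> r) (at (Q x))"
    and H\<gamma>_sym: "\<And>r u v. r \<in> {1..m} \<Longrightarrow> blinfun_apply (H\<gamma> r u) v = blinfun_apply (H\<gamma> r v) u"
    by metis
  have dL: "((\<lambda>y. differential L (Q y, V y)) has_derivative (\<lambda>w. HL (Q' w, V' w))) (at x within M)"
    by (rule has_derivative_compose[OF has_derivative_Pair[OF Q V] HL])
  have dg: "((\<lambda>y. differential g (Q y)) has_derivative (\<lambda>w. Hg (Q' w))) (at x within M)"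
    by (rule has_derivative_compose[OF Q Hg])
  have d\<gamma>: "((\<lambda>y. differential (\<gamma> r) (Q y)) has_derivative (\<lambda>w. H\<gamma> r (Q' w))) (at x within M)"
    if "r \<in> {1..m}" for r
    by (rule has_derivative_compose[OF Q H\<gamma>[OF that]])
  define P' where "P' w = HL (Q' w, V' w) o\<^sub>L in_velocity" for w
  define I' where "I' w = (h * b j) *\<^sub>R ((HL (Q' w, V' w) o\<^sub>L in_position) +
      ((blinfun_inner_right (\<Lambda> x) o\<^sub>L Hg (Q' w)) + (blinfun_inner_right (\<Lambda>' w) o\<^sub>L differential g (Q x))))
      + (\<Sum>r=1..m. W j r *\<^sub>R H\<gamma> r (Q' w))" for w
  note comp = bounded_bilinear.FDERIV[OF bounded_bilinear_blinfun_compose]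
  have dP: "((\<lambda>y. dL_dv L (Q y) (V y)) has_derivative P') (at x within M)"
    unfolding dL_dv_eq[OF L] P'_def
    using comp[OF dL has_derivative_const] by simp
  have dp: "((\<lambda>y. dL_dq L (Q y) (V y)) has_derivative (\<lambda>w. HL (Q' w, V' w) o\<^sub>L in_position)) (at x within M)"
    unfolding dL_dq_eq[OF L]
    using comp[OF dL has_derivative_const] by simp
  have dc: "((\<lambda>y. constraint_force g (Q y) (\<Lambda> y)) has_derivative
      (\<lambda>w. (blinfun_inner_right (\<Lambda> x) o\<^sub>L Hg (Q' w)) + (blinfun_inner_right (\<Lambda>' w) o\<^sub>L differential g (Q x))))
      (at x within M)"
    unfolding constraint_force_def
    by (rule comp[OF bounded_linear.has_derivative[OF bounded_linear_blinfun_inner_right \<Lambda>] dg])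
  have dI: "((\<lambda>y. stage_impulse L g \<gamma> b W m h j (Q y) (V y) (\<Lambda> y)) has_derivative I') (at x within M)"
    unfolding stage_impulse_def I'_def
    by (intro has_derivative_add has_derivative_sum has_derivative_scaleR_right dp dc d\<gamma>)
  have sym: "I' w1 (Q' w2) + h * b j * P' w1 (V' w2) = I' w2 (Q' w1) + h * b j * P' w2 (V' w1)"
    if "differential g (Q x) (Q' w1) = 0" "differential g (Q x) (Q' w2) = 0" for w1 w2
  proof -
    have form: "I' w (Q' w') + h * b j * P' w (V' w')
        = h * b j * (HL (Q' w, V' w) (Q' w', V' w') + \<Lambda> x \<bullet> Hg (Q' w) (Q' w'))
          + (\<Sum>r=1..m. W j r * H\<gamma> r (Q' w) (Q' w'))"
      if "differential g (Q x) (Q' w') = 0" for w w'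
    proof -
      have "HL (Q' w, V' w) (Q' w', V' w') = HL (Q' w, V' w) ((Q' w', 0) + (0, V' w'))" by simp
      also have "\<dots> = HL (Q' w, V' w) (Q' w', 0) + HL (Q' w, V' w) (0, V' w')"
        by (rule blinfun.add_right)
      finally show ?thesis
        unfolding I'_def P'_def
        by (simp add: blinfun.add_left blinfun.scaleR_left blinfun.sum_left that algebra_simps)
    qed
    show ?thesis
      unfolding form[OF that(1)] form[OF that(2)]
      by (simp add: HL_sym[of "(Q' w1, _)"] Hg_sym[of "Q' w1"] H\<gamma>_sym[of _ "Q' w1"])
  qed
  from that[OF dI dP sym] show ?thesis .
qed

text \<open>The derivative of the flow is read off from the update formulas, with arbitrary derivatives of
  the stage quantities within $T^*S$. The stage equations, and \<open>g = 0\<close> at the stages, are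
  inherited by these derivatives on tangent vectors, where the pairing argument applies.\<close>

theorem vprk_flow_preserves_canonical_form:
  fixes L :: "'q::euclidean_space \<times> 'q \<Rightarrow> real" and g :: "'q \<Rightarrow> real^'d::finite"
  assumes L: "smooth_on UNIV L" and \<gamma>: "\<And>r. r \<in> {1..m} \<Longrightarrow> smooth_on UNIV (\<gamma> r)"
    and g: "smooth_on UNIV g" and b: "\<And>i. i \<in> {1..s} \<Longrightarrow> b i \<noteq> 0"
    and flow: "vprk_flow L g \<gamma> a b W s m h F \<Lambda>"
  shows "preserves_canonical_form (cotangent_S L g) F"
proof -
  define M where "M = cotangent_S L g"
  have diff\<Lambda>: "\<And>i. i \<in> {1..s} \<Longrightarrow> (\<lambda>x. \<Lambda> x i) differentiable_on M"
    using flow unfolding vprk_flow_def M_def by blast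
  obtain Q V P where
    diff: "\<And>i. i \<in> {1..s} \<Longrightarrow> (\<lambda>x. Q x i) differentiable_on M" 
      "\<And>i. i \<in> {1..s} \<Longrightarrow> (\<lambda>x. V x i) differentiable_on M"
    and step: "\<And>x. x \<in> M \<Longrightarrow> vprk_step L g \<gamma> a b W s m h x (F x) (Q x) (V x) (P x) (\<Lambda> x)"
    using flow unfolding vprk_flow_def M_def by blast
  define I where "I x j = stage_impulse L g \<gamma> b W m h j (Q x j) (V x j) (\<Lambda> x j)" for x j
  have eqs: "\<forall>i\<in>{1..s}. Q x i = fst x + h *\<^sub>R (\<Sum>j=1..s. a i j *\<^sub>R V x j)"
    "\<forall>i\<in>{1..s}. dL_dv L (Q x i) (V x i) = snd x + (\<Sum>j=1..s. (1 - a j i / b i) *\<^sub>R I x j)"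
    "\<forall>i\<in>{1..s}. g (Q x i) = 0"
    "F x = (fst x + h *\<^sub>R (\<Sum>j=1..s. b j *\<^sub>R V x j), snd x + (\<Sum>j=1..s. I x j))"
    if "x \<in> M" for x
  proof -
    have "vprk_step L g \<gamma> a b W s m h (fst x, snd x) (fst (F x), snd (F x)) (Q x) (V x) (P x) (\<Lambda> x)"
      using step[OF that] by simp
    note S = this[unfolded vprk_step_iff_impulse Let_def, folded I_def]
    show "\<forall>i\<in>{1..s}. Q x i = fst x + h *\<^sub>R (\<Sum>j=1..s. a i j *\<^sub>R V x j)"
      "\<forall>i\<in>{1..s}. g (Q x i) = 0"
      using S by blast+
    show "\<forall>i\<in>{1..s}. dL_dv L (Q x i) (V x i) = snd x + (\<Sum>j=1..s. (1 - a j i / b i) *\<^sub>R I x j)"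
      using S by metis
    show "F x = (fst x + h *\<^sub>R (\<Sum>j=1..s. b j *\<^sub>R V x j), snd x + (\<Sum>j=1..s. I x j))"
      using S by (simp add: prod_eq_iff)
  qed
  show ?thesis
    unfolding preserves_canonical_form_def M_def[symmetric]
  proof
    fix x assume x: "x \<in> M"
    define stage_derivatives where "stage_derivatives i Q' V' I' P' \<longleftrightarrow>
        ((\<lambda>x. Q x i) has_derivative Q') (at x within M) \<and>
        ((\<lambda>x. V x i) has_derivative V') (at x within M) \<and>
        ((\<lambda>x. I x i) has_derivative I') (at x within M) \<and>
        ((\<lambda>x. dL_dv L (Q x i) (V x i)) has_derivative P') (at x within M) \<and>
        (\<forall>w1 w2. differential g (Q x i) (Q' w1) = 0 \<longrightarrow> differential g (Q x i) (Q' w2) = 0 \<longrightarrow>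
          blinfun_apply (I' w1) (Q' w2) + h * b i * blinfun_apply (P' w1) (V' w2)
          = I' w2 (Q' w1) + h * b i * P' w2 (V' w1))" for i Q' V' I' P'
    have "\<exists>Q' V' I' P'. stage_derivatives i Q' V' I' P'" if i: "i \<in> {1..s}" for i
    proof -
      obtain Q' V' \<Lambda>' where Q': "((\<lambda>x. Q x i) has_derivative Q') (at x within M)"
        and V': "((\<lambda>x. V x i) has_derivative V') (at x within M)"
        and \<Lambda>': "((\<lambda>x. \<Lambda> x i) has_derivative \<Lambda>') (at x within M)"
        using diff[OF i] diff\<Lambda>[OF i] x unfolding differentiable_on_def differentiable_def by blast
      show ?thesis
        unfolding I_def stage_derivatives_def
        by (rule stage_impulse_has_derivative[OF L \<gamma> g Q' V' \<Lambda>', where b = b and j = i and h = h and W = W])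
          (use Q' V' in \<open>blast+\<close>)
    qed
    then obtain Q' V' I' P' where K: "\<And>i. i \<in> {1..s} \<Longrightarrow> stage_derivatives i (Q' i) (V' i) (I' i) (P' i)"
      by metis
    have Q': "((\<lambda>x. Q x i) has_derivative Q' i) (at x within M)"
      and V': "((\<lambda>x. V x i) has_derivative V' i) (at x within M)"
      and I': "((\<lambda>x. I x i) has_derivative I' i) (at x within M)"
      and P': "((\<lambda>x. dL_dv L (Q x i) (V x i)) has_derivative P' i) (at x within M)"
      and sym: "\<And>w1 w2. differential g (Q x i) (Q' i w1) = 0 \<Longrightarrow> differential g (Q x i) (Q' i w2) = 0 \<Longrightarrow>
          blinfun_apply (I' i w1) (Q' i w2) + h * b i * blinfun_apply (P' i w1) (V' i w2)
          = I' i w2 (Q' i w1) + h * b i * P' i w2 (V' i w1)"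
      if "i \<in> {1..s}" for i
      using K[OF that] unfolding stage_derivatives_def by blast+
    define F' where
      "F' w = (fst w + h *\<^sub>R (\<Sum>j=1..s. b j *\<^sub>R V' j w), snd w + (\<Sum>j=1..s. I' j w))" for w
    have fst': "(fst has_derivative fst) (at x within M)" and snd': "(snd has_derivative snd) (at x within M)"
      by (intro bounded_linear_imp_has_derivative bounded_linear_fst bounded_linear_snd)+
    have "((\<lambda>x. (fst x + h *\<^sub>R (\<Sum>j=1..s. b j *\<^sub>R V x j), snd x + (\<Sum>j=1..s. I x j)))
        has_derivative F') (at x within M)"
      unfolding F'_def
      by (intro has_derivative_Pair has_derivative_add has_derivative_scaleR_right has_derivative_sum
          fst' snd' V' I')
    then have dF: "(F has_derivative F') (at x within M)"
      using x eqs(4) by (rule has_derivative_transform[rotated 2])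
    have Q'_eq: "Q' i w = fst w + h *\<^sub>R (\<Sum>j=1..s. a i j *\<^sub>R V' j w)"
      if "i \<in> {1..s}" "w \<in> tangent_vectors M x" for i w
      by (rule derivative_eq_on_tangent_vectors[OF Q'[OF that(1)] _ bspec[OF eqs(1) that(1)] that(2)])
        (intro has_derivative_add has_derivative_scaleR_right has_derivative_sum fst' V')
    have P'_eq: "P' i w = snd w + (\<Sum>j=1..s. (1 - a j i / b i) *\<^sub>R I' j w)"
      if "i \<in> {1..s}" "w \<in> tangent_vectors M x" for i w
      by (rule derivative_eq_on_tangent_vectors[OF P'[OF that(1)] _ bspec[OF eqs(2) that(1)] that(2)])
        (intro has_derivative_add has_derivative_scaleR_right has_derivative_sum snd' I')
    have g': "differential g (Q x i) (Q' i w) = 0" if "i \<in> {1..s}" "w \<in> tangent_vectors M x" for i w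
      by (rule derivative_eq_on_tangent_vectors[OF
            has_derivative_compose[OF Q'[OF that(1)] smooth_on_has_derivative[OF g]]
            has_derivative_const bspec[OF eqs(3) that(1)] that(2)])
    have "canonical_form (F' w1) (F' w2) = canonical_form w1 w2"
      if w: "w1 \<in> tangent_vectors M x" "w2 \<in> tangent_vectors M x" for w1 w2
    proof (rule canonical_form_vprk_step)
      fix i assume i: "i \<in> {1..s}"
      show "b i \<noteq> 0" by (rule b[OF i])
      show "blinfun_apply (I' i w1) (Q' i w2) + h * b i * blinfun_apply (P' i w1) (V' i w2)
          = I' i w2 (Q' i w1) + h * b i * P' i w2 (V' i w1)"
        by (rule sym[OF i g'[OF i w(1)] g'[OF i w(2)]])
      fix w assume "w \<in> {w1, w2}"
      with w have "w \<in> tangent_vectors M x" by blast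
      then show "Q' i w = fst w + h *\<^sub>R (\<Sum>j=1..s. a i j *\<^sub>R V' j w)"
        and "P' i w = snd w + (\<Sum>j=1..s. (1 - a j i / b i) *\<^sub>R I' j w)"
        by (rule Q'_eq[OF i] P'_eq[OF i])+
    qed (rule F'_def)
    with dF show "\<exists>F'. (F has_derivative F') (at x within M) \<and>
        (\<forall>w1\<in>tangent_vectors M x. \<forall>w2\<in>tangent_vectors M x.
           canonical_form (F' w1) (F' w2) = canonical_form w1 w2)"
      by blast
  qed
qed

section \<open>Critical points of the action sum\<close>

text \<open>One step of the stationarity conditions of the action sum; each line belongs to the variation
  of one of the variables \<open>p\<^sub>k\<^sup>i\<close>, \<open>p\<^sub>k\<^sub>+\<^sub>1\<close>, \<open>Q\<^sub>k\<^sup>i\<close>, \<open>V\<^sub>k\<^sup>i\<close>, \<open>q\<^sub>k\<close> and \<open>\<Lambda>\<^sub>k\<^sup>i\<close>.\<close>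

definition discrete_euler_lagrange ::
    "('q::euclidean_space \<times> 'q \<Rightarrow> real) \<Rightarrow> ('q \<Rightarrow> real^'d) \<Rightarrow> (nat \<Rightarrow> 'q \<Rightarrow> real) \<Rightarrow>
     (nat \<Rightarrow> nat \<Rightarrow> real) \<Rightarrow> (nat \<Rightarrow> real) \<Rightarrow> (nat \<Rightarrow> nat \<Rightarrow> real) \<Rightarrow> nat \<Rightarrow> nat \<Rightarrow> real \<Rightarrow>
     'q \<times> 'q dual \<Rightarrow> 'q \<times> 'q dual \<Rightarrow>
     (nat \<Rightarrow> 'q) \<Rightarrow> (nat \<Rightarrow> 'q) \<Rightarrow> (nat \<Rightarrow> 'q dual) \<Rightarrow> (nat \<Rightarrow> real^'d::finite) \<Rightarrow> bool" where
  "discrete_euler_lagrange L g \<gamma> a b W s m h x x' Q V S \<Lambda> \<longleftrightarrow>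
     (\<forall>i\<in>{1..s}. (1 / h) *\<^sub>R (Q i - fst x) - (\<Sum>j=1..s. a i j *\<^sub>R V j) = 0) \<and>
     (1 / h) *\<^sub>R (fst x' - fst x) - (\<Sum>j=1..s. b j *\<^sub>R V j) = 0 \<and>
     (\<forall>i\<in>{1..s}. stage_impulse L g \<gamma> b W m h i (Q i) (V i) (\<Lambda> i) + S i = 0) \<and>
     (\<forall>i\<in>{1..s}. b i *\<^sub>R dL_dv L (Q i) (V i) - (\<Sum>j=1..s. a j i *\<^sub>R S j) - b i *\<^sub>R snd x' = 0) \<and>
     snd x - snd x' - (\<Sum>j=1..s. S j) = 0 \<and>
     (\<forall>i\<in>{1..s}. g (Q i) = 0)"

text \<open>The stage momenta of the action sum are the negative stage impulses; eliminating them
  leaves the momentum equations of the method.\<close>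

lemma discrete_euler_lagrange_iff_vprk_step:
  fixes x x' :: "'q::euclidean_space \<times> 'q dual"
  assumes h: "h > 0" and b: "\<And>i. i \<in> {1..s} \<Longrightarrow> b i \<noteq> 0"
  shows "(\<exists>S. discrete_euler_lagrange L g \<gamma> a b W s m h x x' Q V S \<Lambda>)
     \<longleftrightarrow> (\<exists>P. vprk_step L g \<gamma> a b W s m h x x' Q V P \<Lambda>)"
proof -
  obtain q p q' p' where x: "x = (q, p)" "x' = (q', p')" by force
  define I where "I j = stage_impulse L g \<gamma> b W m h j (Q j) (V j) (\<Lambda> j)" for j
  define kin where "kin \<longleftrightarrow> (\<forall>i\<in>{1..s}. Q i = q + h *\<^sub>R (\<Sum>j=1..s. a i j *\<^sub>R V j)) \<and>
    q' = q + h *\<^sub>R (\<Sum>j=1..s. b j *\<^sub>R V j) \<and> (\<forall>i\<in>{1..s}. g (Q i) = 0)"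
  define mom where "mom \<longleftrightarrow> p' = p + (\<Sum>j=1..s. I j) \<and>
    (\<forall>i\<in>{1..s}. dL_dv L (Q i) (V i) = p + (\<Sum>j=1..s. (1 - a j i / b i) *\<^sub>R I j))"
  have position: "(1 / h) *\<^sub>R (y - z) - v = 0 \<longleftrightarrow> y = z + h *\<^sub>R v" for y z v :: 'q
  proof -
    have "(1 / h) *\<^sub>R (y - z) - v = (1 / h) *\<^sub>R (y - (z + h *\<^sub>R v))"
      using h by (simp add: scaleR_diff_right scaleR_add_right)
    then show ?thesis using h by simp
  qed
  have velocity: "b i *\<^sub>R P - (\<Sum>j=1..s. a j i *\<^sub>R S j) - b i *\<^sub>R p' = 0
      \<longleftrightarrow> P = p + (\<Sum>j=1..s. (1 - a j i / b i) *\<^sub>R I j)"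
    if i: "i \<in> {1..s}" and S: "\<forall>j\<in>{1..s}. I j + S j = 0" and p': "p' = p + (\<Sum>j=1..s. I j)"
    for i P S
  proof -
    have "(\<Sum>j=1..s. a j i *\<^sub>R S j) = b i *\<^sub>R (\<Sum>j=1..s. (- a j i / b i) *\<^sub>R I j)"
      unfolding scaleR_sum_right
      by (intro sum.cong refl) (use S b[OF i] in \<open>auto simp: add_eq_0_iff\<close>)
    then have "b i *\<^sub>R P - (\<Sum>j=1..s. a j i *\<^sub>R S j) - b i *\<^sub>R p'
        = b i *\<^sub>R (P - (p + (\<Sum>j=1..s. (1 - a j i / b i) *\<^sub>R I j)))"
      unfolding p'
      by (simp add: scaleR_diff_left sum_subtractf sum_negf scaleR_diff_right scaleR_add_right)
    then show ?thesis using b[OF i] by simp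
  qed
  have "discrete_euler_lagrange L g \<gamma> a b W s m h x x' Q V S \<Lambda>
      \<longleftrightarrow> kin \<and> mom \<and> (\<forall>i\<in>{1..s}. I i + S i = 0)" for S
  proof -
    have "(p - p' - (\<Sum>j=1..s. S j) = 0) \<longleftrightarrow> p' = p + (\<Sum>j=1..s. I j)"
      if "\<forall>i\<in>{1..s}. I i + S i = 0"
    proof -
      have "(\<Sum>j=1..s. S j) = - (\<Sum>j=1..s. I j)"
        unfolding sum_negf[symmetric]
        by (intro sum.cong refl) (use that in \<open>auto simp: add_eq_0_iff\<close>)
      then show ?thesis by (auto simp: algebra_simps)
    qed
    then show ?thesis
      unfolding discrete_euler_lagrange_def kin_def mom_def x fst_conv snd_conv position I_def[symmetric]
      using velocity[of _ S] by blast
  qed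
  moreover have "(\<exists>P. vprk_step L g \<gamma> a b W s m h x x' Q V P \<Lambda>) \<longleftrightarrow> kin \<and> mom"
    unfolding x vprk_step_iff_impulse Let_def I_def[symmetric] kin_def mom_def
    by (auto intro!: exI[of _ "\<lambda>i. dL_dv L (Q i) (V i)"])
  moreover have "\<exists>S. \<forall>i\<in>{1..s}. I i + S i = 0"
    by (intro exI[of _ "\<lambda>i. - I i"]) simp
  ultimately show ?thesis by blast
qed

text \<open>The first variation, with the terms collected by the varied quantity. The momentum \<open>p0\<close> does
  not occur in the action sum; shifting the index in the sum of the terms \<open>p\<^sub>k\<^sub>+\<^sub>1 (\<delta>q\<^sub>k\<^sub>+\<^sub>1)\<close>
  introduces it with the coefficient \<open>\<delta>q\<^sub>0 = 0\<close>.\<close>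

lemma action_sum_first_variation:
  fixes L :: "'q::euclidean_space \<times> 'q \<Rightarrow> real" and g :: "'q \<Rightarrow> real^'d::finite"
    and c \<delta> :: "('q, 'd) discrete_curve"
  assumes L: "smooth_on UNIV L" and \<gamma>: "\<And>r. r \<in> {1..m} \<Longrightarrow> smooth_on UNIV (\<gamma> r)"
    and g: "smooth_on UNIV g" and h: "h > 0"
    and ends: "pos \<delta> 0 = 0" "pos \<delta> N = 0"
    and p_def: "p = (mom c)(0 := p0)"
  shows "((\<lambda>\<epsilon>. action_sum L g \<gamma> a b W s m h N (vary c \<delta> \<epsilon>)) has_real_derivative
    (\<Sum>k<N.
      (\<Sum>i=1..s.
          (stage_impulse L g \<gamma> b W m h i (stage_pos c k i) (stage_vel c k i) (multiplier c k i)
            + stage_mom c k i) (stage_pos \<delta> k i)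
        + h * (b i *\<^sub>R dL_dv L (stage_pos c k i) (stage_vel c k i)
            - (\<Sum>j=1..s. a j i *\<^sub>R stage_mom c k j) - b i *\<^sub>R p (Suc k)) (stage_vel \<delta> k i)
        + h * b i * (multiplier \<delta> k i \<bullet> g (stage_pos c k i))
        + h * stage_mom \<delta> k i
            ((1 / h) *\<^sub>R (stage_pos c k i - pos c k) - (\<Sum>j=1..s. a i j *\<^sub>R stage_vel c k j)))
      + h * mom \<delta> (Suc k) ((1 / h) *\<^sub>R (pos c (Suc k) - pos c k) - (\<Sum>j=1..s. b j *\<^sub>R stage_vel c k j))
      + (p k - p (Suc k) - (\<Sum>j=1..s. stage_mom c k j)) (pos \<delta> k))) (at 0)"
    (is "(_ has_real_derivative (\<Sum>k<N. ?D k)) _")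
proof -
  let ?Q = "stage_pos c" and ?V = "stage_vel c" and ?S = "stage_mom c" and ?\<Lambda> = "multiplier c"
  let ?dQ = "stage_pos \<delta>" and ?dV = "stage_vel \<delta>" and ?dS = "stage_mom \<delta>" and ?d\<Lambda> = "multiplier \<delta>"
  define E where "E k i = (1 / h) *\<^sub>R (?Q k i - pos c k) - (\<Sum>j=1..s. a i j *\<^sub>R ?V k j)" for k i
  define E' where "E' k = (1 / h) *\<^sub>R (pos c (Suc k) - pos c k) - (\<Sum>j=1..s. b j *\<^sub>R ?V k j)" for k
  define dE where "dE k i = (1 / h) *\<^sub>R (?dQ k i - pos \<delta> k) - (\<Sum>j=1..s. a i j *\<^sub>R ?dV k j)" for k i
  define dE' where "dE' k = (1 / h) *\<^sub>R (pos \<delta> (Suc k) - pos \<delta> k) - (\<Sum>j=1..s. b j *\<^sub>R ?dV k j)" for k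
  have line: "((\<lambda>\<epsilon>. f (y + \<epsilon> *\<^sub>R v)) has_vector_derivative differential f y v) (at 0)"
    if "smooth_on UNIV f"
    for f :: "'z::real_normed_vector \<Rightarrow> 'y::real_normed_vector" and y v
  proof -
    have "((\<lambda>\<epsilon>. f (y + \<epsilon> *\<^sub>R v)) has_derivative (\<lambda>t. differential f (y + 0 *\<^sub>R v) (t *\<^sub>R v))) (at 0)"
      by (rule has_derivative_compose[OF _ smooth_on_has_derivative[OF that]])
        (auto intro!: derivative_eq_intros)
    then show ?thesis
      by (simp add: has_vector_derivative_def blinfun.scaleR_right)
  qed
  have dLag: "((\<lambda>\<epsilon>. L (?Q k i + \<epsilon> *\<^sub>R ?dQ k i, ?V k i + \<epsilon> *\<^sub>R ?dV k i)) has_real_derivative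
      (dL_dq L (?Q k i) (?V k i) (?dQ k i) + dL_dv L (?Q k i) (?V k i) (?dV k i))) (at 0)" for k i
    using line[OF L, of "(?Q k i, ?V k i)" "(?dQ k i, ?dV k i)"]
    unfolding has_real_derivative_iff_has_vector_derivative
    by (simp add: differential_Pair_split[OF L])
  have d\<gamma>: "((\<lambda>\<epsilon>. \<gamma> r (?Q k i + \<epsilon> *\<^sub>R ?dQ k i)) has_real_derivative
      differential (\<gamma> r) (?Q k i) (?dQ k i)) (at 0)" if "r \<in> {1..m}" for r k i
    using line[OF \<gamma>[OF that]] unfolding has_real_derivative_iff_has_vector_derivative .
  have lin: "((\<lambda>\<epsilon>. y + \<epsilon> *\<^sub>R v) has_vector_derivative v) (at (0::real))"
    for y v :: "'z::real_normed_vector"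
    by (auto intro!: derivative_eq_intros simp: has_vector_derivative_def)
  have d\<Lambda>: "((\<lambda>\<epsilon>. (?\<Lambda> k i + \<epsilon> *\<^sub>R ?d\<Lambda> k i) \<bullet> g (?Q k i + \<epsilon> *\<^sub>R ?dQ k i)) has_real_derivative
      (?d\<Lambda> k i \<bullet> g (?Q k i) + constraint_force g (?Q k i) (?\<Lambda> k i) (?dQ k i))) (at 0)" for k i
    using bounded_bilinear.has_vector_derivative[OF bounded_bilinear_inner lin line[OF g]]
    unfolding has_real_derivative_iff_has_vector_derivative
    by (simp add: constraint_force_apply add.commute)
  have pair: "((\<lambda>\<epsilon>. blinfun_apply (A + \<epsilon> *\<^sub>R A') (v + \<epsilon> *\<^sub>R v')) has_real_derivative (A v' + A' v)) (at 0)"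
    for A A' :: "'q dual" and v v'
    using bounded_bilinear.has_vector_derivative[OF bounded_bilinear_blinfun_apply lin lin]
    unfolding has_real_derivative_iff_has_vector_derivative by simp
  have Eline: "(1 / h) *\<^sub>R ((y + \<epsilon> *\<^sub>R dy) - (z + \<epsilon> *\<^sub>R dz)) - (\<Sum>j=1..s. co j *\<^sub>R (?V k j + \<epsilon> *\<^sub>R ?dV k j))
     = ((1 / h) *\<^sub>R (y - z) - (\<Sum>j=1..s. co j *\<^sub>R ?V k j))
      + \<epsilon> *\<^sub>R ((1 / h) *\<^sub>R (dy - dz) - (\<Sum>j=1..s. co j *\<^sub>R ?dV k j))" for y z dy dz co k \<epsilon>
    by (simp add: algebra_simps sum.distrib scaleR_sum_right)
  define R where "R k = (\<Sum>i=1..s.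
          h * b i * (dL_dq L (?Q k i) (?V k i) (?dQ k i) + dL_dv L (?Q k i) (?V k i) (?dV k i))
        + (\<Sum>r=1..m. W i r * differential (\<gamma> r) (?Q k i) (?dQ k i))
        + h * b i * (?d\<Lambda> k i \<bullet> g (?Q k i) + constraint_force g (?Q k i) (?\<Lambda> k i) (?dQ k i))
        + h * (?S k i (dE k i) + ?dS k i (E k i)))
      + h * (mom c (Suc k) (dE' k) + mom \<delta> (Suc k) (E' k))" for k
  have deriv: "((\<lambda>\<epsilon>. action_sum L g \<gamma> a b W s m h N (vary c \<delta> \<epsilon>)) has_real_derivative (\<Sum>k<N. R k)) (at 0)"
    unfolding action_sum_def vary_def discrete_curve.simps Eline R_def E_def E'_def dE_def dE'_def
    by (intro DERIV_sum DERIV_add DERIV_cmult dLag d\<gamma> d\<Lambda> pair)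
  \<comment> \<open>The terms with \<open>\<delta>q\<^sub>k\<^sub>+\<^sub>1\<close> are moved to the next step; the correction telescopes.\<close>
  have R: "R k = ?D k + (p (Suc k) (pos \<delta> (Suc k)) - p k (pos \<delta> k))" for k
  proof -
    have S: "(\<Sum>i=1..s. h * ?S k i (dE k i))
      = (\<Sum>i=1..s. ?S k i (?dQ k i)) - (\<Sum>i=1..s. ?S k i (pos \<delta> k))
        - (\<Sum>i=1..s. \<Sum>j=1..s. h * (a j i * ?S k j (?dV k i)))"
    proof -
      have "h * ?S k i (dE k i) = ?S k i (?dQ k i) - ?S k i (pos \<delta> k)
          - (\<Sum>j=1..s. h * (a i j * ?S k i (?dV k j)))" for i
        unfolding dE_def using h
        by (simp add: blinfun.diff_right blinfun.sum_right blinfun.scaleR_right right_diff_distrib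
            sum_distrib_left)
      then show ?thesis
        by (simp add: sum_subtractf) (rule sum.swap)
    qed
    have M: "h * p (Suc k) (dE' k) = p (Suc k) (pos \<delta> (Suc k)) - p (Suc k) (pos \<delta> k)
        - (\<Sum>j=1..s. h * (b j * p (Suc k) (?dV k j)))"
      unfolding dE'_def using h
      by (simp add: blinfun.diff_right blinfun.sum_right blinfun.scaleR_right right_diff_distrib
          sum_distrib_left)
    have p: "mom c (Suc k) = p (Suc k)" unfolding p_def by simp
    have "R k = (\<Sum>i=1..s. stage_impulse L g \<gamma> b W m h i (?Q k i) (?V k i) (?\<Lambda> k i) (?dQ k i)
          + h * b i * dL_dv L (?Q k i) (?V k i) (?dV k i)
          + h * b i * (?d\<Lambda> k i \<bullet> g (?Q k i)) + h * ?dS k i (E k i))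
        + (\<Sum>i=1..s. h * ?S k i (dE k i)) + h * p (Suc k) (dE' k) + h * mom \<delta> (Suc k) (E' k)"
      unfolding R_def stage_impulse_def p
      by (simp add: sum.distrib[symmetric] blinfun.add_left blinfun.scaleR_left blinfun.sum_left algebra_simps)
    also have "\<dots> = ?D k + (p (Suc k) (pos \<delta> (Suc k)) - p k (pos \<delta> k))"
      unfolding S M E_def E'_def
      by (simp add: sum.distrib sum_subtractf blinfun.add_left blinfun.diff_left blinfun.scaleR_left
          blinfun.sum_left right_diff_distrib sum_distrib_left mult.assoc)
    finally show ?thesis .
  qed
  have "(\<Sum>k<N. p (Suc k) (pos \<delta> (Suc k)) - p k (pos \<delta> k)) = p N (pos \<delta> N) - p 0 (pos \<delta> 0)"
    by (rule sum_lessThan_telescope)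
  then have "(\<Sum>k<N. R k) = (\<Sum>k<N. ?D k)"
    unfolding R sum.distrib by (simp add: ends)
  with deriv show ?thesis by simp
qed

definition riesz_vector :: "'q::euclidean_space dual \<Rightarrow> 'q" where
  "riesz_vector A = (\<Sum>u\<in>Basis. blinfun_apply A u *\<^sub>R u)"

lemma riesz_vector_pairing:
  "blinfun_apply A (riesz_vector A) \<ge> 0"
  "blinfun_apply A (riesz_vector A) = 0 \<longleftrightarrow> A = 0"
proof -
  have eq: "blinfun_apply A (riesz_vector A) = (\<Sum>u\<in>Basis. (blinfun_apply A u)\<^sup>2)"
    unfolding riesz_vector_def by (simp add: blinfun.sum_right blinfun.scaleR_right power2_eq_square)
  show "blinfun_apply A (riesz_vector A) \<ge> 0"
    unfolding eq by (simp add: sum_nonneg)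
  show "blinfun_apply A (riesz_vector A) = 0 \<longleftrightarrow> A = 0"
    unfolding eq by (auto simp: sum_nonneg_eq_0_iff intro: blinfun_euclidean_eqI)
qed

text \<open>All stationarity conditions follow from a single variation: when each varied quantity is dual
  to its coefficient in the first variation, the latter is a sum of nonnegative terms. At \<open>k = 0\<close>,
  where \<open>\<delta>q\<^sub>0 = 0\<close> gives no condition, the momentum balance is the choice of \<open>p0\<close>.\<close>

lemma critical_point_iff_euler_lagrange:
  fixes L :: "'q::euclidean_space \<times> 'q \<Rightarrow> real" and g :: "'q \<Rightarrow> real^'d::finite"
    and c :: "('q, 'd) discrete_curve"
  assumes L: "smooth_on UNIV L" and \<gamma>: "\<And>r. r \<in> {1..m} \<Longrightarrow> smooth_on UNIV (\<gamma> r)"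
    and g: "smooth_on UNIV g" and h: "h > 0" and b: "\<And>i. i \<in> {1..s} \<Longrightarrow> b i \<noteq> 0"
  shows "critical_point N (action_sum L g \<gamma> a b W s m h N) c \<longleftrightarrow>
    (\<exists>p0. \<forall>k<N. discrete_euler_lagrange L g \<gamma> a b W s m h
       (pos c k, ((mom c)(0 := p0)) k) (pos c (Suc k), ((mom c)(0 := p0)) (Suc k))
       (stage_pos c k) (stage_vel c k) (stage_mom c k) (multiplier c k))"
    (is "?crit \<longleftrightarrow> (\<exists>p0. ?EL p0)")
proof
  assume "\<exists>p0. ?EL p0"
  then obtain p0 where EL: "?EL p0" ..
  show ?crit
    unfolding critical_point_def
  proof (intro allI impI)
    fix \<delta> :: "('q, 'd) discrete_curve"
    assume "pos \<delta> 0 = 0 \<and> pos \<delta> N = 0"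
    then have ends: "pos \<delta> 0 = 0" "pos \<delta> N = 0" by auto
    have *: "z = 0 \<Longrightarrow> (f has_real_derivative z) F \<Longrightarrow> (f has_real_derivative 0) F" for z f F by simp
    show "((\<lambda>\<epsilon>. action_sum L g \<gamma> a b W s m h N (vary c \<delta> \<epsilon>)) has_real_derivative 0) (at 0)"
      by (rule *[OF _ action_sum_first_variation[OF L \<gamma> g h ends refl, where ?p0.0 = p0]],
          rule sum.neutral, use EL in \<open>simp add: discrete_euler_lagrange_def\<close>)
  qed
next
  assume crit: ?crit
  define p0 where "p0 = mom c (Suc 0) + (\<Sum>j=1..s. stage_mom c 0 j)"
  define p where "p = (mom c)(0 := p0)"
  define X where "X k i = stage_impulse L g \<gamma> b W m h i (stage_pos c k i) (stage_vel c k i) (multiplier c k i)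
      + stage_mom c k i" for k i
  define Y where "Y k i = b i *\<^sub>R dL_dv L (stage_pos c k i) (stage_vel c k i)
      - (\<Sum>j=1..s. a j i *\<^sub>R stage_mom c k j) - b i *\<^sub>R p (Suc k)" for k i
  define Z where "Z k = p k - p (Suc k) - (\<Sum>j=1..s. stage_mom c k j)" for k
  define E where "E k i = (1 / h) *\<^sub>R (stage_pos c k i - pos c k) - (\<Sum>j=1..s. a i j *\<^sub>R stage_vel c k j)" for k i
  define E' where "E' k = (1 / h) *\<^sub>R (pos c (Suc k) - pos c k) - (\<Sum>j=1..s. b j *\<^sub>R stage_vel c k j)" for k
  have Z0: "Z 0 = 0" unfolding Z_def p_def p0_def by simp
  \<comment> \<open>The factor \<open>b i\<close> makes the multiplier term nonnegative for either sign of \<open>b i\<close>.\<close>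
  define \<delta> :: "('q, 'd) discrete_curve" where "\<delta> = \<lparr>
     pos = (\<lambda>k. if k < N then riesz_vector (Z k) else 0),
     mom = (\<lambda>k. blinfun_inner_left (E' (k - 1))),
     stage_pos = (\<lambda>k i. riesz_vector (X k i)),
     stage_vel = (\<lambda>k i. riesz_vector (Y k i)),
     stage_mom = (\<lambda>k i. blinfun_inner_left (E k i)),
     multiplier = (\<lambda>k i. b i *\<^sub>R g (stage_pos c k i))\<rparr>"
  have \<delta>: "stage_pos \<delta> k i = riesz_vector (X k i)" "stage_vel \<delta> k i = riesz_vector (Y k i)"
    "stage_mom \<delta> k i = blinfun_inner_left (E k i)" "multiplier \<delta> k i = b i *\<^sub>R g (stage_pos c k i)"
    "mom \<delta> (Suc k) = blinfun_inner_left (E' k)" "k < N \<Longrightarrow> pos \<delta> k = riesz_vector (Z k)" for k i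
    by (simp_all add: \<delta>_def)
  have ends: "pos \<delta> 0 = 0" "pos \<delta> N = 0"
    by (simp_all add: \<delta>_def Z0 riesz_vector_def)
  define T where "T k i = X k i (riesz_vector (X k i)) + h * Y k i (riesz_vector (Y k i))
      + h * ((b i)\<^sup>2 * (g (stage_pos c k i) \<bullet> g (stage_pos c k i))) + h * (E k i \<bullet> E k i)" for k i
  define D where "D k = (\<Sum>i=1..s. T k i) + h * (E' k \<bullet> E' k) + Z k (riesz_vector (Z k))" for k
  note nonneg = riesz_vector_pairing(1) inner_ge_zero zero_le_power2 mult_nonneg_nonneg add_nonneg_nonneg
    less_imp_le[OF h]
  have T_nonneg: "T k i \<ge> 0" for k i
    unfolding T_def by (intro nonneg)
  have D_nonneg: "D k \<ge> 0" for k
    unfolding D_def by (intro nonneg sum_nonneg T_nonneg)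
  have "((\<lambda>\<epsilon>. action_sum L g \<gamma> a b W s m h N (vary c \<delta> \<epsilon>)) has_real_derivative (\<Sum>k<N. D k)) (at 0)"
    using action_sum_first_variation[where m = m and \<gamma> = \<gamma> and a = a and b = b and W = W and s = s,
        OF L \<gamma> g h ends p_def]
    unfolding X_def[symmetric] Y_def[symmetric] Z_def[symmetric] E_def[symmetric] E'_def[symmetric]
    by (simp add: \<delta> D_def T_def power2_eq_square mult.assoc cong: sum.cong_simp)
  moreover have "((\<lambda>\<epsilon>. action_sum L g \<gamma> a b W s m h N (vary c \<delta> \<epsilon>)) has_real_derivative 0) (at 0)"
    using crit ends unfolding critical_point_def by blast
  ultimately have "(\<Sum>k<N. D k) = 0"
    by (rule DERIV_unique)
  then have D0: "D k = 0" if "k < N" for k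
    using that D_nonneg by (simp add: sum_nonneg_eq_0_iff)
  have "?EL p0"
  proof (intro allI impI)
    fix k assume k: "k < N"
    have "(\<Sum>i=1..s. T k i) \<ge> 0" "h * (E' k \<bullet> E' k) \<ge> 0" "Z k (riesz_vector (Z k)) \<ge> 0"
      by (intro nonneg sum_nonneg T_nonneg)+
    with D0[OF k] have 0: "(\<Sum>i=1..s. T k i) = 0" "h * (E' k \<bullet> E' k) = 0" "Z k (riesz_vector (Z k)) = 0"
      unfolding D_def by linarith+
    have E': "E' k = 0" and Z: "Z k = 0"
      using 0 h riesz_vector_pairing(2)[of "Z k"] by auto
    have stage: "X k i = 0 \<and> Y k i = 0 \<and> g (stage_pos c k i) = 0 \<and> E k i = 0" if i: "i \<in> {1..s}" for i
    proof -
      have "T k i = 0"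
        using 0(1) i T_nonneg by (simp add: sum_nonneg_eq_0_iff)
      moreover have "X k i (riesz_vector (X k i)) \<ge> 0" "h * Y k i (riesz_vector (Y k i)) \<ge> 0"
        "h * ((b i)\<^sup>2 * (g (stage_pos c k i) \<bullet> g (stage_pos c k i))) \<ge> 0" "h * (E k i \<bullet> E k i) \<ge> 0"
        by (intro nonneg)+
      ultimately have "X k i (riesz_vector (X k i)) = 0" "h * Y k i (riesz_vector (Y k i)) = 0"
        "h * ((b i)\<^sup>2 * (g (stage_pos c k i) \<bullet> g (stage_pos c k i))) = 0" "h * (E k i \<bullet> E k i) = 0"
        unfolding T_def by linarith+
      then show ?thesis
        using h b[OF i] riesz_vector_pairing(2) by auto
    qed
    show "discrete_euler_lagrange L g \<gamma> a b W s m h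
       (pos c k, ((mom c)(0 := p0)) k) (pos c (Suc k), ((mom c)(0 := p0)) (Suc k))
       (stage_pos c k) (stage_vel c k) (stage_mom c k) (multiplier c k)"
      unfolding discrete_euler_lagrange_def p_def[symmetric] fst_conv snd_conv
      using stage E' Z unfolding X_def Y_def Z_def E_def E'_def by blast
  qed
  then show "\<exists>p0. ?EL p0" ..
qed

text \<open>A critical point asks for one family of stage momenta for the whole curve, the method for
  stage data at each step; the elimination of the stage momenta is done step by step.\<close>

theorem vprk_iff_critical_point:
  fixes L :: "'q::euclidean_space \<times> 'q \<Rightarrow> real" and g :: "'q \<Rightarrow> real^'d::finite"
    and c :: "('q, 'd) discrete_curve"
  assumes L: "smooth_on UNIV L" and \<gamma>: "\<And>r. r \<in> {1..m} \<Longrightarrow> smooth_on UNIV (\<gamma> r)"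
    and g: "smooth_on UNIV g" and h: "h > 0" and b: "\<And>i. i \<in> {1..s} \<Longrightarrow> b i \<noteq> 0"
  shows "(\<exists>p0 P. \<forall>k<N. vprk_step L g \<gamma> a b W s m h
             (pos c k, ((mom c)(0 := p0)) k) (pos c (Suc k), ((mom c)(0 := p0)) (Suc k))
             (stage_pos c k) (stage_vel c k) (P k) (multiplier c k))
     \<longleftrightarrow> (\<exists>ps. critical_point N (action_sum L g \<gamma> a b W s m h N) (c\<lparr>stage_mom := ps\<rparr>))"
proof -
  define x where "x p0 k = (pos c k, ((mom c)(0 := p0)) k)" for p0 k
  let ?step = "\<lambda>p0 k P. vprk_step L g \<gamma> a b W s m h (x p0 k) (x p0 (Suc k))
      (stage_pos c k) (stage_vel c k) P (multiplier c k)"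
  let ?EL = "\<lambda>p0 k S. discrete_euler_lagrange L g \<gamma> a b W s m h (x p0 k) (x p0 (Suc k))
      (stage_pos c k) (stage_vel c k) S (multiplier c k)"
  have choose: "(\<forall>k<N. \<exists>P. R k P) \<longleftrightarrow> (\<exists>P. \<forall>k<N. R k (P k))" for R :: "nat \<Rightarrow> (nat \<Rightarrow> 'q dual) \<Rightarrow> bool"
    by metis
  have step: "(\<exists>S. ?EL p0 k S) \<longleftrightarrow> (\<exists>P. ?step p0 k P)" for p0 k
    by (rule discrete_euler_lagrange_iff_vprk_step) (fact h, fact b)
  have crit: "critical_point N (action_sum L g \<gamma> a b W s m h N) (c\<lparr>stage_mom := S\<rparr>)
      \<longleftrightarrow> (\<exists>p0. \<forall>k<N. ?EL p0 k (S k))" for S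
    unfolding x_def
    by (subst critical_point_iff_euler_lagrange) (use L \<gamma> g h b in simp_all)
  have "(\<exists>p0 P. \<forall>k<N. ?step p0 k (P k)) \<longleftrightarrow> (\<exists>p0. \<forall>k<N. \<exists>P. ?step p0 k P)"
    unfolding choose ..
  also have "\<dots> \<longleftrightarrow> (\<exists>p0. \<forall>k<N. \<exists>S. ?EL p0 k S)"
    unfolding step ..
  also have "\<dots> \<longleftrightarrow> (\<exists>p0 S. \<forall>k<N. ?EL p0 k (S k))"
    unfolding choose ..
  also have "\<dots> \<longleftrightarrow> (\<exists>S p0. \<forall>k<N. ?EL p0 k (S k))"
    by blast
  also have "\<dots> \<longleftrightarrow> (\<exists>ps. critical_point N (action_sum L g \<gamma> a b W s m h N) (c\<lparr>stage_mom := ps\<rparr>))"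
    unfolding crit ..
  finally show ?thesis
    unfolding x_def .
qed

section \<open>The stochastic method\<close>

theorem theorem4p2:
  fixes L :: "'q::euclidean_space \<times> 'q \<Rightarrow> real"
    and g :: "'q \<Rightarrow> real^'d::finite"
    and \<gamma> :: "nat \<Rightarrow> 'q \<Rightarrow> real"
    and a :: "nat \<Rightarrow> nat \<Rightarrow> real" and b \<nu> \<kappa> :: "nat \<Rightarrow> real"
    and M :: "'w measure" and \<phi> \<psi> :: "nat \<Rightarrow> 'w \<Rightarrow> real"
    and s m N :: nat and h :: real
    and F :: "'w \<Rightarrow> 'q \<times> 'q dual \<Rightarrow> 'q \<times> 'q dual"
    and q1 q2 :: 'q
  assumes "smooth_on UNIV L"
    and "\<And>q v. bij (blinfun_apply (d2L_dv2 L q v))"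
    and "\<And>r. r \<in> {1..m} \<Longrightarrow> smooth_on UNIV (\<gamma> r)"
    and "smooth_on UNIV g" and "zero_is_regular_value g" and "CARD('d) < DIM('q)"
    and "s \<ge> 1" and "\<And>i. i \<in> {1..s} \<Longrightarrow> b i \<noteq> 0"
    and "prob_space M"
    and "\<And>r. r \<in> {1..m} \<Longrightarrow> \<phi> r \<in> borel_measurable M"
    and "\<And>r. r \<in> {1..m} \<Longrightarrow> \<psi> r \<in> borel_measurable M"
    and "h > 0" and "N \<ge> 1"
    and flow: "\<And>\<omega>. \<omega> \<in> space M \<Longrightarrow>
      \<exists>\<Lambda>. vprk_flow L g \<gamma> a b (noise_weight \<nu> \<kappa> \<phi> \<psi> \<omega>) s m h (F \<omega>) \<Lambda>"
  shows
    "(\<forall>\<omega>\<in>space M. \<forall>c\<in>path_space N q1 q2.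
        (\<exists>p0 P. \<forall>k<N.
           vprk_step L g \<gamma> a b (noise_weight \<nu> \<kappa> \<phi> \<psi> \<omega>) s m h
             (pos c k, ((mom c)(0 := p0)) k) (pos c (Suc k), ((mom c)(0 := p0)) (Suc k))
             (stage_pos c k) (stage_vel c k) (P k) (multiplier c k))
        \<longleftrightarrow>
        (\<exists>ps. critical_point N
           (action_sum L g \<gamma> a b (noise_weight \<nu> \<kappa> \<phi> \<psi> \<omega>) s m h N) (c\<lparr>stage_mom := ps\<rparr>)))
     \<and> (\<forall>\<omega>\<in>space M.
        \<exists>\<Lambda>. vprk_flow L g \<gamma> a b (noise_weight \<nu> \<kappa> \<phi> \<psi> \<omega>) s m h (F \<omega>) \<Lambda> \<and>
            preserves_canonical_form (cotangent_S L g) (F \<omega>))"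
proof (intro conjI ballI)
  fix \<omega> and c :: "('q, 'd) discrete_curve"
  show "(\<exists>p0 P. \<forall>k<N.
           vprk_step L g \<gamma> a b (noise_weight \<nu> \<kappa> \<phi> \<psi> \<omega>) s m h
             (pos c k, ((mom c)(0 := p0)) k) (pos c (Suc k), ((mom c)(0 := p0)) (Suc k))
             (stage_pos c k) (stage_vel c k) (P k) (multiplier c k))
        \<longleftrightarrow>
        (\<exists>ps. critical_point N
           (action_sum L g \<gamma> a b (noise_weight \<nu> \<kappa> \<phi> \<psi> \<omega>) s m h N) (c\<lparr>stage_mom := ps\<rparr>))"
    by (rule vprk_iff_critical_point) fact+
next
  fix \<omega> assume "\<omega> \<in> space M"
  then obtain \<Lambda> where \<Lambda>: "vprk_flow L g \<gamma> a b (noise_weight \<nu> \<kappa> \<phi> \<psi> \<omega>) s m h (F \<omega>) \<Lambda>"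
    using flow by blast
  have "preserves_canonical_form (cotangent_S L g) (F \<omega>)"
    by (rule vprk_flow_preserves_canonical_form) fact+
  with \<Lambda> show "\<exists>\<Lambda>. vprk_flow L g \<gamma> a b (noise_weight \<nu> \<kappa> \<phi> \<psi> \<omega>) s m h (F \<omega>) \<Lambda> \<and>
      preserves_canonical_form (cotangent_S L g) (F \<omega>)"
    by blast
qed

end
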